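(* For every integer $n\geq 1$, every $n$-vertex outerplanar graph $G$, and every integer $k\geq 4$, there exists a set $\mathcal I\subseteq V(G)$ such that $G[\mathcal I]$ has maximum degree at most $k$ and $|\mathcal I|\geq \frac{2k+1}{2k+5}n$ if $k$ is even, and $|\mathcal I|\geq \frac{2k+2/3}{2k+14/3}n$ if $k$ is odd.
   Context: An outerplanar graph is a (simple) graph admitting a planar drawing in which every vertex is incident to the outer face. $G[\mathcal I]$ denotes the subgraph of $G$ induced by $\mathcal I$. *)

theory Defs
  imports "HOL-Analysis.Analysis"
begin

record 'a graph =
  verts :: "'a set"
  edges :: "'a set set"

definition simple_graph :: "'a graph \<Rightarrow> bool" where
  "simple_graph G \<longleftrightarrow> finite (verts G) \<and> (\<forall>e \<in> edges G. e \<subseteq> verts G \<and> card e = 2)"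

definition induced_subgraph :: "'a graph \<Rightarrow> 'a set \<Rightarrow> 'a graph" where
  "induced_subgraph G I = \<lparr>verts = I, edges = {e \<in> edges G. e \<subseteq> I}\<rparr>"

definition degree :: "'a graph \<Rightarrow> 'a \<Rightarrow> nat" where
  "degree G v = card {e \<in> edges G. v \<in> e}"

(* The inserted 0 gives the empty graph maximum degree 0. *)
definition max_degree :: "'a graph \<Rightarrow> nat" where
  "max_degree G = Max (insert 0 (degree G ` verts G))"

(* Vertices are drawn as distinct points and each edge as a Jordan arc joining its two end points;
   the interior of an edge contains no vertex and no point of another edge. *)
definition planar_drawing ::
    "'a graph \<Rightarrow> ('a \<Rightarrow> complex) \<Rightarrow> ('a set \<Rightarrow> real \<Rightarrow> complex) \<Rightarrow> bool" where
  "planar_drawing G p \<gamma> \<longleftrightarrow>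
     inj_on p (verts G) \<and>
     (\<forall>e \<in> edges G. arc (\<gamma> e) \<and> {pathstart (\<gamma> e), pathfinish (\<gamma> e)} = p ` e) \<and>
     (\<forall>e \<in> edges G. (path_image (\<gamma> e) - p ` e) \<inter>
        (p ` verts G \<union> (\<Union>f \<in> edges G - {e}. path_image (\<gamma> f))) = {})"

definition drawing_points ::
    "'a graph \<Rightarrow> ('a \<Rightarrow> complex) \<Rightarrow> ('a set \<Rightarrow> real \<Rightarrow> complex) \<Rightarrow> complex set" where
  "drawing_points G p \<gamma> = p ` verts G \<union> (\<Union>e \<in> edges G. path_image (\<gamma> e))"

(* The drawing of a finite graph is compact, so its complement has exactly one unbounded component;
   for such a set, outside is that component. *)
definition outer_face ::
    "'a graph \<Rightarrow> ('a \<Rightarrow> complex) \<Rightarrow> ('a set \<Rightarrow> real \<Rightarrow> complex) \<Rightarrow> complex set" where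
  "outer_face G p \<gamma> = outside (drawing_points G p \<gamma>)"

definition outerplanar :: "'a graph \<Rightarrow> bool" where
  "outerplanar G \<longleftrightarrow> simple_graph G \<and>
     (\<exists>p \<gamma>. planar_drawing G p \<gamma> \<and> (\<forall>v \<in> verts G. p v \<in> frontier (outer_face G p \<gamma>)))"

end

theory Submission
  imports Defs
begin

text \<open>
  The only consequence of outerplanarity that is used is that no minor is a $K_{2,3}$. By contraction
  it bounds, for a vertex set \<open>S\<close> with \<open>s\<close> elements and its complement with \<open>r\<close> elements, the number
  of edges that meet \<open>S\<close> by \<open>3 s + r\<close>, and the number of edges between \<open>S\<close> and its complement by
  \<open>2 s + r\<close>.

  Delete vertices of degree at least \<open>k + 1\<close> one by one. The deleted set \<open>S\<close> meets at least \<open>(k + 1) s\<close>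
  edges, hence \<open>(k - 2) s \<le> r\<close>, which is enough for \<open>k \<ge> 5\<close>. For \<open>k = 4\<close>, first delete \<open>s\<close> vertices of
  degree at least \<open>6\<close> until the maximum degree is at most \<open>5\<close>, and then a maximal independent set of \<open>t\<close>
  vertices of degree \<open>5\<close>. The two bounds give \<open>6 s + 5 t \<le> 3 (s + t) + r\<close> and \<open>5 t \<le> 2 t + r\<close>, and
  three times the first plus the second is \<open>9 (s + t) \<le> 4 r\<close>.
\<close>

section \<open>Theta curves\<close>

text \<open>If all three arcs reach the outer face, each one runs outside the Jordan curve formed by the
  other two. Then the inside of \<open>c1 \<union> c2\<close> lies outside both \<open>c1 \<union> c3\<close> and \<open>c2 \<union> c3\<close>, and
  Janiszewski's theorem connects it to infinity off the whole theta curve.\<close>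

lemma theta_curve_outside:
  fixes c1 c2 c3 :: "real \<Rightarrow> complex"
  assumes arc: "arc c1" "arc c2" "arc c3"
    and ends: "pathstart c1 = a" "pathstart c2 = a" "pathstart c3 = a"
      "pathfinish c1 = b" "pathfinish c2 = b" "pathfinish c3 = b"
    and int12: "path_image c1 \<inter> path_image c2 \<subseteq> {a, b}"
    and int13: "path_image c1 \<inter> path_image c3 \<subseteq> {a, b}"
    and int23: "path_image c2 \<inter> path_image c3 \<subseteq> {a, b}"
    and x1: "x1 \<in> path_image c1 - {a, b}"
    and x2: "x2 \<in> path_image c2 - {a, b}"
    and x3: "x3 \<in> path_image c3 - {a, b}"
    and clo: "{x1, x2, x3} \<subseteq> closure (outside (path_image c1 \<union> path_image c2 \<union> path_image c3))"
  shows False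
proof -
  define T where "T = path_image c1 \<union> path_image c2 \<union> path_image c3"
  define J where "J c d = path_image c \<union> path_image d" for c d :: "real \<Rightarrow> complex"
  have jordan: "inside (J c d) \<noteq> {} \<and> open (inside (J c d)) \<and> connected (inside (J c d)) \<and>
      outside (J c d) \<noteq> {} \<and> open (outside (J c d)) \<and> connected (outside (J c d)) \<and>
      frontier (inside (J c d)) = J c d \<and> frontier (outside (J c d)) = J c d \<and> compact (J c d)"
    if "arc c" "arc d" "pathstart c = a" "pathstart d = a" "pathfinish c = b" "pathfinish d = b"
      "path_image c \<inter> path_image d \<subseteq> {a, b}" for c d
  proof -
    have "simple_path (c +++ reversepath d)"
      by (rule simple_path_join_loop) (use that in \<open>auto simp: arc_reversepath\<close>)
    moreover have "pathfinish (c +++ reversepath d) = pathstart (c +++ reversepath d)"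
      using that by simp
    moreover have "path_image (c +++ reversepath d) = J c d"
      using that by (simp add: path_image_join J_def)
    ultimately show ?thesis
      using Jordan_inside_outside[of "c +++ reversepath d"] that
      by (auto simp: J_def compact_Un compact_arc_image)
  qed
  note j12 = jordan[OF arc(1,2) ends(1,2,4,5) int12]
  note j13 = jordan[OF arc(1,3) ends(1,3,4,6) int13]
  note j23 = jordan[OF arc(2,3) ends(2,3,5,6) int23]
  \<comment> \<open>Passing to the smaller set \<open>J c d\<close> enlarges the outside, and the
    closure of that outside adds only points of \<open>J c d\<close> itself.\<close>
  have in_out: "x \<in> outside (J c d)"
    if "x \<in> closure (outside T)" "x \<notin> J c d" "J c d \<subseteq> T"
      "frontier (outside (J c d)) = J c d" for x c d
  proof -
    have "x \<in> closure (outside (J c d))"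
      using that closure_mono[OF outside_mono] by blast
    then show ?thesis
      using that by (auto simp: closure_Un_frontier)
  qed
  have sub_T: "J c1 c2 \<subseteq> T" "J c1 c3 \<subseteq> T" "J c2 c3 \<subseteq> T"
    by (auto simp: J_def T_def)
  have notin: "x1 \<notin> J c2 c3" "x2 \<notin> J c1 c3" "x3 \<notin> J c1 c2"
    using x1 x2 x3 int12 int13 int23 unfolding J_def by blast+
  have clo': "x1 \<in> closure (outside T)" "x2 \<in> closure (outside T)" "x3 \<in> closure (outside T)"
    using clo by (simp_all add: T_def)
  have xo: "x1 \<in> outside (J c2 c3)" "x2 \<in> outside (J c1 c3)" "x3 \<in> outside (J c1 c2)"
    using in_out[OF clo'(1) notin(1) sub_T(3)] in_out[OF clo'(2) notin(2) sub_T(2)]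
      in_out[OF clo'(3) notin(3) sub_T(1)] j12 j13 j23 by simp_all
  have c3_out: "path_image c3 - {a, b} \<subseteq> outside (J c1 c2)"
  proof -
    have "connected (path_image c3 - {a, b})"
      using connected_simple_path_endless[of c3] arc ends by (simp add: arc_imp_simple_path)
    moreover have "path_image c3 - {a, b} \<subseteq> inside (J c1 c2) \<union> outside (J c1 c2)"
      using int13 int23 unfolding inside_Un_outside J_def by blast
    moreover have "(path_image c3 - {a, b}) \<inter> outside (J c1 c2) \<noteq> {}"
      using x3 xo by blast
    ultimately show ?thesis
      using connectedD[of "path_image c3 - {a, b}" "inside (J c1 c2)" "outside (J c1 c2)"]
        j12 inside_Int_outside[of "J c1 c2"] by blast
  qed
  have ab: "a \<in> J c1 c2" "b \<in> J c1 c2"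
    using pathstart_in_path_image[of c1] pathfinish_in_path_image[of c1] ends by (auto simp: J_def)
  have in_disj: "inside (J c1 c2) \<inter> T = {}"
    using c3_out inside_Int_outside[of "J c1 c2"] inside_no_overlap[of "J c1 c2"] ab
    unfolding T_def J_def by blast
  \<comment> \<open>The inside of \<open>J c1 c2\<close> is connected and misses \<open>T\<close>,
    so it lies on one side of \<open>J d c3\<close>. On the inner side, its frontier point
    \<open>x\<close> would be in the closure of the inside of \<open>J d c3\<close>, hence not in
    the outside.\<close>
  have in_sub: "inside (J c1 c2) \<subseteq> outside (J d c3)"
    if "J d c3 \<subseteq> T" "x \<in> J c1 c2" "x \<in> outside (J d c3)"
      "open (inside (J d c3))" "open (outside (J d c3))" "frontier (inside (J d c3)) = J d c3" for d x
  proof -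
    have "inside (J c1 c2) \<subseteq> inside (J d c3) \<union> outside (J d c3)"
      using in_disj that by (auto simp: inside_Un_outside)
    moreover from this have "inside (J d c3) \<inter> inside (J c1 c2) = {} \<or> outside (J d c3) \<inter> inside (J c1 c2) = {}"
      using connectedD[of "inside (J c1 c2)" "inside (J d c3)" "outside (J d c3)"] that j12
      by (simp add: Int_commute)
    ultimately consider "inside (J c1 c2) \<subseteq> inside (J d c3)" | "inside (J c1 c2) \<subseteq> outside (J d c3)"
      by blast
    then show ?thesis
    proof cases
      case 1
      have "x \<in> closure (inside (J c1 c2))"
        using that j12 by (auto simp: closure_Un_frontier)
      then have "x \<in> closure (inside (J d c3))"
        using closure_mono[OF 1] by blast
      then have "x \<in> inside (J d c3) \<union> J d c3"
        using that by (auto simp: closure_Un_frontier)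
      then show ?thesis
        using that inside_Int_outside[of "J d c3"] outside_no_overlap[of "J d c3"] by blast
    qed
  qed
  have in1: "inside (J c1 c2) \<subseteq> outside (J c2 c3)"
    by (rule in_sub[of c2 x1]) (use j23 x1 xo sub_T in \<open>simp_all add: J_def\<close>)
  have in2: "inside (J c1 c2) \<subseteq> outside (J c1 c3)"
    by (rule in_sub[of c1 x2]) (use j13 x2 xo sub_T in \<open>simp_all add: J_def\<close>)
  obtain z where z: "z \<in> inside (J c1 c2)" using j12 by blast
  have "compact T" using arc by (auto simp: T_def compact_Un compact_arc_image)
  then obtain y where y: "y \<in> outside T"
    using outside_bounded_nonempty compact_imp_bounded by blast
  have y': "y \<in> outside (J c d)" if "J c d \<subseteq> T" for c d
    using y outside_mono[OF that] by blast
  have cc: "connected_component (- J c d) z y"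
    if "J c d \<subseteq> T" "connected (outside (J c d))" "z \<in> outside (J c d)" for c d
  proof -
    have "outside (J c d) \<subseteq> - J c d" by (auto simp: outside_def)
    then show ?thesis
      unfolding connected_component_def using that y'[OF that(1)] by (intro exI[of _ "outside (J c d)"]) simp
  qed
  \<comment> \<open>The two curves share exactly the arc \<open>c3\<close>, which is connected; as
    neither of them separates \<open>z\<close> from \<open>y\<close>, their union does not
    either.\<close>
  have "connected_component (- (J c2 c3 \<union> J c1 c3)) z y"
  proof (rule Janiszewski)
    have "{a, b} \<subseteq> path_image c3"
      using pathstart_in_path_image[of c3] pathfinish_in_path_image[of c3] ends by simp
    then have "J c2 c3 \<inter> J c1 c3 = path_image c3"
      using int12 unfolding J_def by blast
    then show "connected (J c2 c3 \<inter> J c1 c3)"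
      using arc by (simp add: connected_arc_image)
    show "connected_component (- J c2 c3) z y"
      by (rule cc) (use j23 z in1 sub_T in auto)
    show "connected_component (- J c1 c3) z y"
      by (rule cc) (use j13 z in2 sub_T in auto)
  qed (use j23 j13 in \<open>simp_all add: compact_imp_closed\<close>)
  moreover have "- (J c2 c3 \<union> J c1 c3) \<subseteq> - J c1 c2"
    by (auto simp: J_def)
  ultimately have "connected_component (- J c1 c2) z y"
    using connected_component_of_subset by blast
  moreover have "y \<in> outside (J c1 c2)"
    by (rule y') (auto simp: T_def J_def)
  ultimately have "z \<in> outside (J c1 c2)"
    using outside_same_component connected_component_sym by blast
  then show False
    using z inside_Int_outside by blast
qed

text \<open>A body \<open>D\<close> with three limbs that may meet each other only inside \<open>D\<close>, and a tip on each limb.\<close>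

definition forked :: "complex set \<Rightarrow> complex set \<Rightarrow> complex set \<Rightarrow> complex set \<Rightarrow>
    complex \<Rightarrow> complex \<Rightarrow> complex \<Rightarrow> bool" where
  "forked D E1 E2 E3 x1 x2 x3 \<longleftrightarrow>
     (\<forall>S \<in> {D, E1, E2, E3}. closed S \<and> path_connected S) \<and>
     (\<forall>S \<in> {E1, E2, E3}. D \<inter> S \<noteq> {}) \<and>
     E1 \<inter> E2 \<subseteq> D \<and> E1 \<inter> E3 \<subseteq> D \<and> E2 \<inter> E3 \<subseteq> D \<and>
     x1 \<in> E1 - D \<and> x2 \<in> E2 - D \<and> x3 \<in> E3 - D"

text \<open>An arc from \<open>x1\<close> to \<open>x2\<close> inside
  \<open>D \<union> E1 \<union> E2\<close> has to pass through \<open>D\<close>. An arc inside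
  \<open>D \<union> E3\<close> from \<open>x3\<close> to a point of it in \<open>D\<close>, cut off
  at the first hit, supplies the third leg, and that hit is the centre.\<close>

lemma tripod:
  fixes D E1 E2 E3 :: "complex set"
  assumes "forked D E1 E2 E3 x1 x2 x3"
  obtains a g1 g2 g3 where "arc g1" "arc g2" "arc g3"
    "pathstart g1 = a" "pathstart g2 = a" "pathstart g3 = a"
    "pathfinish g1 = x1" "pathfinish g2 = x2" "pathfinish g3 = x3"
    "path_image g1 \<union> path_image g2 \<union> path_image g3 \<subseteq> D \<union> E1 \<union> E2 \<union> E3"
    "path_image g1 \<inter> path_image g2 = {a}" "path_image g1 \<inter> path_image g3 = {a}"
    "path_image g2 \<inter> path_image g3 = {a}"
proof -
  have pc: "path_connected D" "path_connected E1" "path_connected E2" "path_connected E3"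
    and cl: "closed D" "closed E1" "closed E2" "closed E3"
    and meet: "D \<inter> E1 \<noteq> {}" "D \<inter> E2 \<noteq> {}" "D \<inter> E3 \<noteq> {}"
    and disj: "E1 \<inter> E2 \<subseteq> D" "E1 \<inter> E3 \<subseteq> D" "E2 \<inter> E3 \<subseteq> D"
    and x: "x1 \<in> E1 - D" "x2 \<in> E2 - D" "x3 \<in> E3 - D"
    using assms unfolding forked_def by simp_all
  have "path_connected (D \<union> E1 \<union> E2)"
    using pc meet by (intro path_connected_Un) auto
  moreover have "x1 \<noteq> x2" using x disj by blast
  ultimately obtain g where g: "arc g" "path_image g \<subseteq> D \<union> E1 \<union> E2" "pathstart g = x1" "pathfinish g = x2"
    using x unfolding path_connected_arcwise by (metis DiffD1 UnCI)
  \<comment> \<open>Otherwise \<open>E1\<close> and \<open>E2\<close> would split the connected arc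
    into two closed parts, disjoint because \<open>E1 \<inter> E2 \<subseteq> D\<close>.\<close>
  have "path_image g \<inter> D \<noteq> {}"
  proof
    assume 0: "path_image g \<inter> D = {}"
    have "connected (path_image g)" using g connected_arc_image by blast
    moreover have "x1 \<in> path_image g" "x2 \<in> path_image g" using g by force+
    ultimately show False
      using 0 connected_closedD[of "path_image g" E1 E2] cl g x disj by blast
  qed
  then obtain d where d: "d \<in> path_image g" "d \<in> D" by blast
  have "path_connected (D \<union> E3)"
    using pc meet by (intro path_connected_Un) auto
  moreover have "d \<noteq> x3" using x d by blast
  ultimately obtain h where h: "arc h" "path_image h \<subseteq> D \<union> E3" "pathstart h = x3" "pathfinish h = d"
    using x d unfolding path_connected_arcwise by (metis DiffD1 UnCI)
  \<comment> \<open>The times at which \<open>h\<close> is on \<open>g\<close>. Before the least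
    one, \<open>h\<close> stays off \<open>g\<close>, so the third leg meets the other two only in
    \<open>a\<close>.\<close>
  define K where "K = {t \<in> {0..1}. h t \<in> path_image g}"
  have "closed (path_image g)" using g closed_arc_image by blast
  moreover have "continuous_on {0..1} h" using h arc_imp_path path_def by blast
  ultimately have "closed K"
    using continuous_closed_preimage[of "{0..1}" h "path_image g"]
    by (simp add: K_def vimage_def Int_def)
  then have "compact K"
    by (metis K_def bounded_closed_interval bounded_subset compact_eq_bounded_closed mem_Collect_eq subsetI)
  moreover have "1 \<in> K" using h d by (auto simp: K_def pathfinish_def)
  ultimately obtain t where t: "t \<in> K" "\<And>s. s \<in> K \<Longrightarrow> t \<le> s"
    using compact_attains_inf[of K] by blast
  define a where "a = h t"
  have a: "a \<in> path_image g" "a \<in> path_image h" and t01: "t \<in> {0..1}"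
    using t by (auto simp: a_def K_def path_image_def)
  \<comment> \<open>The point \<open>a\<close> lies on both arcs, and limbs meet only inside
    \<open>D\<close>, so it differs from all three tips and no leg degenerates.\<close>
  have aD: "a \<in> D \<union> E3" using a h by blast
  have ne: "a \<noteq> x1" "a \<noteq> x2" "a \<noteq> x3"
    using aD a g x disj by blast+
  have t0: "t \<noteq> 0" using ne h by (auto simp: a_def pathstart_def)
  obtain u where u: "u \<in> {0..1}" "a = g u" using a by (auto simp: path_image_def)
  have u01: "u \<noteq> 0" "u \<noteq> 1" using u ne g by (auto simp: pathstart_def pathfinish_def)
  define g1 where "g1 = subpath u 0 g"
  define g2 where "g2 = subpath u 1 g"
  define g3 where "g3 = subpath t 0 h"
  have im1: "path_image g1 = g ` {0..u}" and im2: "path_image g2 = g ` {u..1}" and im3: "path_image g3 = h ` {0..t}"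
    using u t01 by (auto simp: g1_def g2_def g3_def path_image_subpath)
  have sub: "path_image g1 \<subseteq> path_image g" "path_image g2 \<subseteq> path_image g" "path_image g3 \<subseteq> path_image h"
    unfolding g1_def g2_def g3_def using u t01 by (simp_all add: path_image_subpath_subset)
  have inj: "inj_on g {0..1}" using g arc_imp_inj_on by blast
  have i3: "path_image g3 \<inter> path_image g \<subseteq> {a}"
  proof
    fix z assume "z \<in> path_image g3 \<inter> path_image g"
    then obtain s where s: "s \<in> {0..t}" "z = h s" "z \<in> path_image g" by (auto simp: im3)
    then have "s \<in> K" using t01 by (auto simp: K_def)
    then show "z \<in> {a}" using t(2)[of s] s by (auto simp: a_def)
  qed
  have st: "pathstart g1 = a" "pathstart g2 = a" "pathstart g3 = a"
    using u by (auto simp: g1_def g2_def g3_def a_def)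
  have ain: "a \<in> path_image g1" "a \<in> path_image g2" "a \<in> path_image g3"
    using st by (metis pathstart_in_path_image)+
  show thesis
  proof (rule that)
    show "arc g1" "arc g2" "arc g3"
      unfolding g1_def g2_def g3_def using g h u u01 t01 t0 by (auto intro!: arc_subpath_arc)
    show "pathstart g1 = a" "pathstart g2 = a" "pathstart g3 = a" by (rule st)+
    show "pathfinish g1 = x1" "pathfinish g2 = x2" "pathfinish g3 = x3"
      using g h by (auto simp: g1_def g2_def g3_def pathstart_def pathfinish_def subpath_def)
    show "path_image g1 \<union> path_image g2 \<union> path_image g3 \<subseteq> D \<union> E1 \<union> E2 \<union> E3"
      using sub g h by blast
    show "path_image g1 \<inter> path_image g3 = {a}" "path_image g2 \<inter> path_image g3 = {a}"
      using ain sub i3 by blast+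
    have "path_image g1 \<inter> path_image g2 = g ` ({0..u} \<inter> {u..1})"
      unfolding im1 im2 using u by (intro inj_on_image_Int[OF inj, symmetric]) auto
    also have "{0..u} \<inter> {u..1} = {u}" using u by auto
    finally show "path_image g1 \<inter> path_image g2 = {a}" using u by simp
  qed
qed

text \<open>Each leg of one tripod followed by the reversed leg of the other with the same tip gives
  three arcs between the two centres: a theta curve whose arcs all reach the outside. This is the
  topological form of a K_{2,3}.\<close>

lemma two_tripods:
  assumes f: "forked D E1 E2 E3 x1 x2 x3" "forked D' E1' E2' E3' x1 x2 x3"
    and meet: "(D \<union> E1 \<union> E2 \<union> E3) \<inter> (D' \<union> E1' \<union> E2' \<union> E3') \<subseteq> {x1, x2, x3}"
    and clo: "{x1, x2, x3} \<subseteq>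
      closure (outside ((D \<union> E1 \<union> E2 \<union> E3) \<union> (D' \<union> E1' \<union> E2' \<union> E3')))"
  shows False
proof -
  obtain a g1 g2 g3 where g: "arc g1" "arc g2" "arc g3"
    "pathstart g1 = a" "pathstart g2 = a" "pathstart g3 = a"
    "pathfinish g1 = x1" "pathfinish g2 = x2" "pathfinish g3 = x3"
    "path_image g1 \<union> path_image g2 \<union> path_image g3 \<subseteq> D \<union> E1 \<union> E2 \<union> E3"
    "path_image g1 \<inter> path_image g2 = {a}" "path_image g1 \<inter> path_image g3 = {a}"
    "path_image g2 \<inter> path_image g3 = {a}"
    by (rule tripod[OF f(1)])
  obtain b h1 h2 h3 where h: "arc h1" "arc h2" "arc h3"
    "pathstart h1 = b" "pathstart h2 = b" "pathstart h3 = b"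
    "pathfinish h1 = x1" "pathfinish h2 = x2" "pathfinish h3 = x3"
    "path_image h1 \<union> path_image h2 \<union> path_image h3 \<subseteq> D' \<union> E1' \<union> E2' \<union> E3'"
    "path_image h1 \<inter> path_image h2 = {b}" "path_image h1 \<inter> path_image h3 = {b}"
    "path_image h2 \<inter> path_image h3 = {b}"
    by (rule tripod[OF f(2)])
  have xg: "x1 \<in> path_image g1" "x2 \<in> path_image g2" "x3 \<in> path_image g3"
    using g by (metis pathfinish_in_path_image)+
  have xh: "x1 \<in> path_image h1" "x2 \<in> path_image h2" "x3 \<in> path_image h3"
    using h by (metis pathfinish_in_path_image)+
  have ne: "a \<noteq> x1" "a \<noteq> x2" "a \<noteq> x3" "b \<noteq> x1" "b \<noteq> x2" "b \<noteq> x3"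
    using g h arc_distinct_ends by metis+
  have gh: "path_image g \<inter> path_image h \<subseteq> {x1, x2, x3}"
    if "g \<in> {g1, g2, g3}" "h \<in> {h1, h2, h3}" for g h
    using that meet g(10) h(10) by blast
  have sep: "z \<notin> T" if "z \<in> S" "S \<inter> T = {c}" "c \<noteq> z" for z c :: complex and S T using that by auto
  have sep': "z \<notin> S" if "z \<in> T" "S \<inter> T = {c}" "c \<noteq> z" for z c :: complex and S T using that by auto
  \<comment> \<open>A tip lies on its own leg only, because legs of one tripod share just the
    centre, and a centre is not a tip. Hence legs of different tripods can meet only in the tip of
    equal index.\<close>
  have x_sep: "x1 \<notin> path_image g2" "x1 \<notin> path_image g3" "x2 \<notin> path_image g1"
    "x2 \<notin> path_image g3" "x3 \<notin> path_image g1" "x3 \<notin> path_image g2"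
    "x1 \<notin> path_image h2" "x1 \<notin> path_image h3" "x2 \<notin> path_image h1"
    "x2 \<notin> path_image h3" "x3 \<notin> path_image h1" "x3 \<notin> path_image h2"
    by (fact sep[OF xg(1) g(11) ne(1)] sep[OF xg(1) g(12) ne(1)] sep'[OF xg(2) g(11) ne(2)]
        sep[OF xg(2) g(13) ne(2)] sep'[OF xg(3) g(12) ne(3)] sep'[OF xg(3) g(13) ne(3)]
        sep[OF xh(1) h(11) ne(4)] sep[OF xh(1) h(12) ne(4)] sep'[OF xh(2) h(11) ne(5)]
        sep[OF xh(2) h(13) ne(5)] sep'[OF xh(3) h(12) ne(6)] sep'[OF xh(3) h(13) ne(6)])+
  have gh1: "path_image g1 \<inter> path_image h1 \<subseteq> {x1}" "path_image g2 \<inter> path_image h2 \<subseteq> {x2}"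
    "path_image g3 \<inter> path_image h3 \<subseteq> {x3}"
    using gh[of g1 h1] gh[of g2 h2] gh[of g3 h3] x_sep by auto
  have gh0: "path_image g1 \<inter> path_image h2 = {}" "path_image g1 \<inter> path_image h3 = {}"
    "path_image g2 \<inter> path_image h1 = {}" "path_image g2 \<inter> path_image h3 = {}"
    "path_image g3 \<inter> path_image h1 = {}" "path_image g3 \<inter> path_image h2 = {}"
    using gh[of g1 h2] gh[of g1 h3] gh[of g2 h1] gh[of g2 h3] gh[of g3 h1] gh[of g3 h2] x_sep by auto
  define c1 where "c1 = g1 +++ reversepath h1"
  define c2 where "c2 = g2 +++ reversepath h2"
  define c3 where "c3 = g3 +++ reversepath h3"
  have im: "path_image c1 = path_image g1 \<union> path_image h1"
    "path_image c2 = path_image g2 \<union> path_image h2"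
    "path_image c3 = path_image g3 \<union> path_image h3"
    using g h by (simp_all add: c1_def c2_def c3_def path_image_join)
  show False
  proof (rule theta_curve_outside[of c1 c2 c3 a b x1 x2 x3])
    show "arc c1" "arc c2" "arc c3"
      unfolding c1_def c2_def c3_def using g(1-9) h(1-9) gh1
      by (intro arc_join; simp add: arc_reversepath)+
    show "path_image c1 \<inter> path_image c2 \<subseteq> {a, b}"
      unfolding im Int_Un_distrib Int_Un_distrib2 using gh0 g(11) h(11) by (simp add: Int_commute)
    show "path_image c1 \<inter> path_image c3 \<subseteq> {a, b}"
      unfolding im Int_Un_distrib Int_Un_distrib2 using gh0 g(12) h(12) by (simp add: Int_commute)
    show "path_image c2 \<inter> path_image c3 \<subseteq> {a, b}"
      unfolding im Int_Un_distrib Int_Un_distrib2 using gh0 g(13) h(13) by (simp add: Int_commute)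
    show "x1 \<in> path_image c1 - {a, b}" "x2 \<in> path_image c2 - {a, b}" "x3 \<in> path_image c3 - {a, b}"
      unfolding im using xg ne by auto
    have "path_image c1 \<union> path_image c2 \<union> path_image c3 \<subseteq>
        (D \<union> E1 \<union> E2 \<union> E3) \<union> (D' \<union> E1' \<union> E2' \<union> E3')"
      unfolding im using g(10) h(10) by blast
    then show "{x1, x2, x3} \<subseteq> closure (outside (path_image c1 \<union> path_image c2 \<union> path_image c3))"
      using clo closure_mono[OF outside_mono] by blast
  qed (use g h in \<open>simp_all add: c1_def c2_def c3_def\<close>)
qed

section \<open>Edge bounds by contraction\<close>

definition adjacent :: "'a set set \<Rightarrow> 'a set \<Rightarrow> 'a set \<Rightarrow> bool" where
  "adjacent E A B \<longleftrightarrow> (\<exists>u\<in>A. \<exists>v\<in>B. {u, v} \<in> E)"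

text \<open>The predicate \<open>conn\<close> stays abstract, which separates the counting from the
  drawing: branch sets survive contraction, and no five of them form a K_{2,3}. The condition
  \<open>distinct\<close> matters because \<open>pairwise\<close> on a set says nothing about
  coinciding members.\<close>

locale K23_minor_free =
  fixes E :: "'a set set" and conn :: "'a set \<Rightarrow> bool"
  assumes conn_Un: "conn A \<Longrightarrow> conn B \<Longrightarrow> adjacent E A B \<Longrightarrow> conn (A \<union> B)"
    and no_K23: "\<lbrakk>\<And>P. P \<in> {A, B, X, Y, Z} \<Longrightarrow> conn P; pairwise disjnt {A, B, X, Y, Z};
        distinct [A, B, X, Y, Z];
        \<And>P. P \<in> {X, Y, Z} \<Longrightarrow> adjacent E A P \<and> adjacent E B P\<rbrakk> \<Longrightarrow> False"
begin

abbreviation adj :: "'a set \<Rightarrow> 'a set \<Rightarrow> bool" where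
  "adj \<equiv> adjacent E"

text \<open>Families of blobs are handled as minors: a blob is a branch set, and replacing a star of blobs by
  its union is a contraction.\<close>

definition blobs :: "'a set set \<Rightarrow> bool" where
  "blobs \<P> \<longleftrightarrow> finite \<P> \<and> pairwise disjnt \<P> \<and> (\<forall>P\<in>\<P>. conn P)"

definition links :: "'a set set \<Rightarrow> 'a set set \<Rightarrow> ('a set \<times> 'a set) set" where
  "links \<S> \<R> = {(P, Q). P \<in> \<S> \<and> Q \<in> \<R> \<and> adj P Q}"

section \<open>Contraction of stars of blobs\<close>

lemma adj_sym: "adj A B \<longleftrightarrow> adj B A"
  unfolding adjacent_def by (metis insert_commute)

lemma adj_Un_Union: "adj (A \<union> \<Union>\<N>) B \<longleftrightarrow> adj A B \<or> (\<exists>N\<in>\<N>. adj N B)"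
  unfolding adjacent_def by blast

lemma blobs_subset: "blobs \<P> \<Longrightarrow> \<Q> \<subseteq> \<P> \<Longrightarrow> blobs \<Q>"
  unfolding blobs_def using finite_subset pairwise_subset by blast

lemma finite_links: "finite \<S> \<Longrightarrow> finite \<R> \<Longrightarrow> finite (links \<S> \<R>)"
  by (rule finite_subset[of _ "\<S> \<times> \<R>"]) (auto simp: links_def)

lemma conn_star:
  assumes "finite \<N>" "conn X" "\<And>A. A \<in> \<N> \<Longrightarrow> conn A \<and> adj X A"
  shows "conn (X \<union> \<Union>\<N>)"
  using assms(1,3)
proof (induction rule: finite_induct)
  case empty
  then show ?case using assms(2) by simp
next
  case (insert A \<N>)
  have "conn ((X \<union> \<Union>\<N>) \<union> A)"
    by (rule conn_Un) (use insert in \<open>auto simp: adj_Un_Union\<close>)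
  then show ?case by (simp add: Un_ac)
qed

text \<open>The second claim makes later cardinalities exact. The new blob is disjoint from the
  others and nonempty, since a member of \<open>\<N>\<close> gives an edge with an end in
  \<open>X\<close>; \<open>blobs\<close> alone would admit the empty set.\<close>

lemma merge_star:
  assumes bl: "blobs \<P>" and X: "X \<in> \<P>" and N: "\<N> \<subseteq> \<P>" "\<N> \<noteq> {}"
    and adj: "\<And>A. A \<in> \<N> \<Longrightarrow> adj X A"
  shows "blobs (insert (X \<union> \<Union>\<N>) (\<P> - insert X \<N>))"
    and "X \<union> \<Union>\<N> \<notin> \<P> - insert X \<N>"
proof -
  have "conn (X \<union> \<Union>\<N>)"
  proof (rule conn_star)
    show "finite \<N>" using bl N finite_subset unfolding blobs_def by blast
  qed (use bl X N adj in \<open>auto simp: blobs_def\<close>)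
  moreover have disj: "disjnt (X \<union> \<Union>\<N>) Q" if "Q \<in> \<P> - insert X \<N>" for Q
  proof -
    have "disjnt P Q" if "P \<in> insert X \<N>" for P
    proof -
      have "P \<in> \<P>" "Q \<in> \<P>" "P \<noteq> Q" using X N \<open>Q \<in> _\<close> that by auto
      then show ?thesis using bl pairwiseD unfolding blobs_def by metis
    qed
    then show ?thesis by (auto simp: disjnt_def)
  qed
  ultimately show "blobs (insert (X \<union> \<Union>\<N>) (\<P> - insert X \<N>))"
    using bl pairwise_subset[of disjnt \<P> "\<P> - insert X \<N>"]
    by (auto simp: blobs_def pairwise_insert disjnt_sym)
  have "X \<union> \<Union>\<N> \<noteq> {}"
    using N adj unfolding adjacent_def by blast
  then show "X \<union> \<Union>\<N> \<notin> \<P> - insert X \<N>"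
    using disj[of "X \<union> \<Union>\<N>"] disjnt_self_iff_empty[of "X \<union> \<Union>\<N>"] by metis
qed

text \<open>Three common neighbours together with \<open>A\<close> and \<open>B\<close> would form a
  K_{2,3}. All counting uses the forbidden minor through this bound.\<close>

lemma card_common_le:
  assumes bl: "blobs \<P>" and AB: "A \<in> \<P>" "B \<in> \<P>" "A \<noteq> B"
  shows "card {Q \<in> \<P> - {A, B}. adj A Q \<and> adj B Q} \<le> 2"
proof (rule ccontr)
  assume "\<not> ?thesis"
  then have "3 \<le> card {Q \<in> \<P> - {A, B}. adj A Q \<and> adj B Q}" by simp
  then obtain T where T: "T \<subseteq> {Q \<in> \<P> - {A, B}. adj A Q \<and> adj B Q}" "card T = 3"
    by (meson obtain_subset_with_card_n)
  then obtain X Y Z where XYZ: "T = {X, Y, Z}" "X \<noteq> Y" "Y \<noteq> Z" "X \<noteq> Z"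
    by (metis card_3_iff)
  have sub: "{A, B, X, Y, Z} \<subseteq> \<P>" using AB T XYZ by auto
  show False
  proof (rule no_K23[of A B X Y Z])
    show "conn P" if "P \<in> {A, B, X, Y, Z}" for P
      using bl sub that unfolding blobs_def by blast
    show "pairwise disjnt {A, B, X, Y, Z}"
      using bl sub pairwise_subset unfolding blobs_def by blast
    show "distinct [A, B, X, Y, Z]" "\<And>P. P \<in> {X, Y, Z} \<Longrightarrow> adj A P \<and> adj B P"
      using AB T XYZ by auto
  qed
qed

text \<open>The links between neighbours of a common hub \<open>X\<close> and further blobs form a forest: contracting
  \<open>w\<close> with its neighbours merges no two links, since two neighbours of \<open>w\<close> already share \<open>X\<close> and \<open>w\<close>.\<close>

lemma hub_links_le:
  assumes "blobs (insert X (\<A> \<union> \<W>))" "X \<notin> \<A> \<union> \<W>" "\<A> \<inter> \<W> = {}" "\<A> \<noteq> {}"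
    and "\<And>A. A \<in> \<A> \<Longrightarrow> adj X A"
  shows "card (links \<A> \<W>) + 1 \<le> card \<A> + card \<W>"
  using assms
proof (induction "card \<W>" arbitrary: \<A> \<W>)
  case 0
  then have "finite \<W>" "finite \<A>" by (auto simp: blobs_def)
  with 0 have "links \<A> \<W> = {}" "card \<A> \<noteq> 0" by (auto simp: links_def)
  then show ?case by simp
next
  case (Suc n)
  have fin: "finite \<W>" "finite \<A>" using Suc.prems(1) by (auto simp: blobs_def)
  obtain w where w: "w \<in> \<W>" using Suc.hyps(2) by fastforce
  define \<W>' where "\<W>' = \<W> - {w}"
  have cW: "n = card \<W>'" "card \<W> = card \<W>' + 1" "finite \<W>'"
    using Suc.hyps(2) w fin by (auto simp: \<W>'_def)
  define \<N> where "\<N> = {A \<in> \<A>. adj w A}"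
  have N: "\<N> \<subseteq> \<A>" "finite \<N>" using fin by (auto simp: \<N>_def)
  have "links \<A> \<W> = links \<A> \<W>' \<union> (\<lambda>A. (A, w)) ` \<N>"
    using w by (auto simp: links_def \<W>'_def \<N>_def adj_sym)
  then have split: "card (links \<A> \<W>) \<le> card (links \<A> \<W>') + card \<N>"
    using card_Un_le card_image_le[OF N(2)] by (metis add_left_mono le_trans)
  show ?case
  proof (cases "\<N> = {}")
    case True
    have "card (links \<A> \<W>') + 1 \<le> card \<A> + card \<W>'"
    proof (rule Suc.hyps(1))
      show "blobs (insert X (\<A> \<union> \<W>'))"
        by (rule blobs_subset[OF Suc.prems(1)]) (auto simp: \<W>'_def)
    qed (use Suc.prems cW in \<open>auto simp: \<W>'_def\<close>)
    with True split cW show ?thesis by simp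
  next
    case False
    define M where "M = w \<union> \<Union>\<N>"
    define \<A>' where "\<A>' = insert M (\<A> - \<N>)"
    have "w \<in> insert X (\<A> \<union> \<W>)" "\<N> \<subseteq> insert X (\<A> \<union> \<W>)" "\<And>A. A \<in> \<N> \<Longrightarrow> adj w A"
      using w N by (auto simp: \<N>_def)
    note mg = merge_star[OF Suc.prems(1) this(1,2) False this(3), folded M_def]
    have eq: "insert X (\<A>' \<union> \<W>') = insert M (insert X (\<A> \<union> \<W>) - insert w \<N>)"
      using Suc.prems(2,3) w N by (auto simp: \<A>'_def \<W>'_def)
    have IH: "card (links \<A>' \<W>') + 1 \<le> card \<A>' + card \<W>'"
    proof (rule Suc.hyps(1))
      show "blobs (insert X (\<A>' \<union> \<W>'))" using mg eq by simp
      show "X \<notin> \<A>' \<union> \<W>'" "\<A>' \<inter> \<W>' = {}"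
        using mg(2) Suc.prems(2,3) w N by (auto simp: \<A>'_def \<W>'_def)
      have "adj X M"
        using False Suc.prems(5) N adj_Un_Union[of w \<N> X] by (auto simp: M_def adj_sym)
      then show "adj X A" if "A \<in> \<A>'" for A
        using that Suc.prems(5) by (auto simp: \<A>'_def)
    qed (use cW in \<open>auto simp: \<A>'_def\<close>)
    \<comment> \<open>Contraction redirects the links of absorbed blobs to \<open>M\<close>. It is
      injective because two of them with the same target \<open>Q\<close> would have
      \<open>X\<close>, \<open>w\<close> and \<open>Q\<close> as three common neighbours.\<close>
    let ?f = "\<lambda>(A, Q). (if A \<in> \<N> then M else A, Q)"
    have uniq: "A = B" if AB: "A \<in> \<N>" "B \<in> \<N>" and Q: "Q \<in> \<W>'" "adj A Q" "adj B Q" for A B Q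
    proof (rule ccontr)
      assume "A \<noteq> B"
      let ?C = "{R \<in> insert X (\<A> \<union> \<W>) - {A, B}. adj A R \<and> adj B R}"
      have "{X, w, Q} \<subseteq> ?C"
        using AB Q w N Suc.prems by (auto simp: \<N>_def \<W>'_def adj_sym)
      moreover have "X \<noteq> w" "X \<noteq> Q" "w \<noteq> Q"
        using Q w Suc.prems(2) unfolding \<W>'_def by blast+
      then have "card {X, w, Q} = 3" by simp
      moreover have "finite ?C" using fin by simp
      ultimately have "3 \<le> card ?C" by (metis card_mono)
      moreover have "card ?C \<le> 2"
        using card_common_le[OF Suc.prems(1), of A B] AB N \<open>A \<noteq> B\<close> by blast
      ultimately show False by simp
    qed
    have M: "M \<notin> \<A> - \<N>" using mg(2) Suc.prems(3) w by blast
    have "inj_on ?f (links \<A> \<W>')"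
    proof (rule inj_onI)
      fix x y assume xy: "x \<in> links \<A> \<W>'" "y \<in> links \<A> \<W>'" "?f x = ?f y"
      obtain A B Q where eq: "x = (A, Q)" "y = (B, Q)"
        "(if A \<in> \<N> then M else A) = (if B \<in> \<N> then M else B)"
        using xy by (cases x; cases y) auto
      then have mem: "A \<in> \<A>" "B \<in> \<A>" "Q \<in> \<W>'" "adj A Q" "adj B Q"
        using xy by (auto simp: links_def)
      have "A \<in> \<N> \<longleftrightarrow> B \<in> \<N>" using eq(3) mem M by (metis DiffI)
      then show "x = y" using eq mem uniq by (cases "A \<in> \<N>") auto
    qed
    moreover have "?f ` links \<A> \<W>' \<subseteq> links \<A>' \<W>'"
      using adj_Un_Union[of w \<N>, folded M_def] unfolding links_def \<A>'_def
      by (auto split: if_splits)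
    ultimately have "card (links \<A> \<W>') \<le> card (links \<A>' \<W>')"
      by (rule card_inj_on_le) (use fin cW in \<open>simp add: finite_links \<A>'_def\<close>)
    \<comment> \<open>The family \<open>\<A>\<close> loses \<open>card \<N> - 1\<close> members and
      \<open>\<W>\<close> loses one, which together pays exactly for the \<open>card \<N>\<close>
      links at \<open>w\<close>.\<close>
    moreover have "card \<A>' + card \<N> = card \<A> + 1"
      using M N fin card_mono[OF fin(2) N(1)] by (simp add: \<A>'_def card_Diff_subset)
    ultimately show ?thesis using split IH cW by linarith
  qed
qed

text \<open>Induction contracts a blob \<open>X\<close> of \<open>\<R>\<close> with all its
  neighbours into one blob on the \<open>\<S>\<close> side. The lost links are the
  \<open>card \<N>\<close> at \<open>X\<close> and, by \<open>hub_links_le\<close>, at most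
  \<open>card \<N> - 1\<close> that merge with others; the right-hand side decreases by exactly
  \<open>2 * card \<N> - 1\<close>.\<close>

lemma links_le:
  assumes "blobs (\<S> \<union> \<R>)" "\<S> \<inter> \<R> = {}"
  shows "card (links \<S> \<R>) \<le> 2 * card \<S> + card \<R>"
  using assms
proof (induction "card \<R>" arbitrary: \<S> \<R>)
  case 0
  then have "finite \<R>" by (auto simp: blobs_def)
  with 0 show ?case by (auto simp: links_def)
next
  case (Suc n)
  have fin: "finite \<R>" "finite \<S>" using Suc.prems(1) by (auto simp: blobs_def)
  obtain X where X: "X \<in> \<R>" using Suc.hyps(2) by fastforce
  define \<R>' where "\<R>' = \<R> - {X}"
  have cR: "n = card \<R>'" "card \<R> = card \<R>' + 1" "finite \<R>'"
    using Suc.hyps(2) X fin by (auto simp: \<R>'_def)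
  define \<N> where "\<N> = {A \<in> \<S>. adj X A}"
  have N: "\<N> \<subseteq> \<S>" "finite \<N>" using fin by (auto simp: \<N>_def)
  have "links \<S> \<R> = links \<S> \<R>' \<union> (\<lambda>A. (A, X)) ` \<N>"
    using X by (auto simp: links_def \<R>'_def \<N>_def adj_sym)
  then have split: "card (links \<S> \<R>) \<le> card (links \<S> \<R>') + card \<N>"
    using card_Un_le card_image_le[OF N(2)] by (metis add_left_mono le_trans)
  show ?case
  proof (cases "\<N> = {}")
    case True
    have "card (links \<S> \<R>') \<le> 2 * card \<S> + card \<R>'"
    proof (rule Suc.hyps(1))
      show "blobs (\<S> \<union> \<R>')"
        by (rule blobs_subset[OF Suc.prems(1)]) (auto simp: \<R>'_def)
    qed (use Suc.prems cR in \<open>auto simp: \<R>'_def\<close>)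
    with True split cR show ?thesis by simp
  next
    case False
    define M where "M = X \<union> \<Union>\<N>"
    define \<S>' where "\<S>' = insert M (\<S> - \<N>)"
    have "X \<in> \<S> \<union> \<R>" "\<N> \<subseteq> \<S> \<union> \<R>" "\<And>A. A \<in> \<N> \<Longrightarrow> adj X A"
      using X N by (auto simp: \<N>_def)
    note mg = merge_star[OF Suc.prems(1) this(1,2) False this(3), folded M_def]
    have eq: "\<S>' \<union> \<R>' = insert M (\<S> \<union> \<R> - insert X \<N>)"
      using Suc.prems(2) X N by (auto simp: \<S>'_def \<R>'_def)
    have IH: "card (links \<S>' \<R>') \<le> 2 * card \<S>' + card \<R>'"
    proof (rule Suc.hyps(1))
      show "blobs (\<S>' \<union> \<R>')" using mg eq by simp
      show "\<S>' \<inter> \<R>' = {}" using mg(2) Suc.prems(2) X N by (auto simp: \<S>'_def \<R>'_def)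
    qed (use cR in auto)
    \<comment> \<open>The blobs at which links may merge; after the contraction each of them keeps
      one link, to \<open>M\<close>.\<close>
    define \<W> where "\<W> = {Q \<in> \<R>'. \<exists>A\<in>\<N>. adj A Q}"
    have W: "finite \<W>" "\<W> \<subseteq> \<R>'" using cR by (auto simp: \<W>_def)
    have hub: "card (links \<N> \<W>) + 1 \<le> card \<N> + card \<W>"
    proof (rule hub_links_le[of X])
      show "blobs (insert X (\<N> \<union> \<W>))"
        by (rule blobs_subset[OF Suc.prems(1)]) (use X N W in \<open>auto simp: \<R>'_def\<close>)
    qed (use X N W Suc.prems(2) False in \<open>auto simp: \<R>'_def \<N>_def\<close>)
    have "links \<S> \<R>' \<subseteq> links \<N> \<W> \<union> links (\<S> - \<N>) \<R>'"
      by (auto simp: links_def \<W>_def)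
    then have "card (links \<S> \<R>') \<le> card (links \<N> \<W> \<union> links (\<S> - \<N>) \<R>')"
      using fin cR N W by (intro card_mono finite_UnI finite_links) auto
    then have 1: "card (links \<S> \<R>') \<le> card (links \<N> \<W>) + card (links (\<S> - \<N>) \<R>')"
      using card_Un_le le_trans by blast
    have M: "M \<notin> \<S> - \<N>" using mg(2) Suc.prems(2) X by blast
    then have "links (\<S> - \<N>) \<R>' \<inter> Pair M ` \<W> = {}" unfolding links_def by blast
    moreover have "card (Pair M ` \<W>) = card \<W>" by (simp add: card_image inj_on_def)
    ultimately have "card (links (\<S> - \<N>) \<R>') + card \<W> = card (links (\<S> - \<N>) \<R>' \<union> Pair M ` \<W>)"
      using fin cR W by (simp add: card_Un_disjoint finite_links)
    also have "\<dots> \<le> card (links \<S>' \<R>')"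
    proof (rule card_mono)
      show "finite (links \<S>' \<R>')" using fin cR by (simp add: finite_links \<S>'_def)
      show "links (\<S> - \<N>) \<R>' \<union> Pair M ` \<W> \<subseteq> links \<S>' \<R>'"
        using adj_Un_Union[of X \<N>, folded M_def] unfolding links_def \<S>'_def \<W>_def by auto
    qed
    finally have 2: "card (links (\<S> - \<N>) \<R>') + card \<W> \<le> card (links \<S>' \<R>')" .
    have "card \<S>' + card \<N> = card \<S> + 1"
      using M N fin card_mono[OF fin(2) N(1)] by (simp add: \<S>'_def card_Diff_subset)
    moreover have "card \<N> \<noteq> 0" using False N by simp
    ultimately show ?thesis using split IH hub 1 2 cR by linarith
  qed
qed

text \<open>Unordered pairs, unlike \<open>links\<close>: two adjacent blobs inside
  \<open>\<S>\<close> must count once.\<close>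

definition touching :: "'a set set \<Rightarrow> 'a set set \<Rightarrow> 'a set set set" where
  "touching \<S> \<R> = {{P, Q} |P Q. P \<in> \<S> \<and> Q \<in> \<S> \<union> \<R> \<and> P \<noteq> Q \<and> adj P Q}"

lemma touchingI: "\<lbrakk>P \<in> \<S>; Q \<in> \<S> \<union> \<R>; P \<noteq> Q; adj P Q\<rbrakk> \<Longrightarrow> {P, Q} \<in> touching \<S> \<R>"
  unfolding touching_def by blast

lemma touchingE:
  assumes "e \<in> touching \<S> \<R>"
  obtains P Q where "e = {P, Q}" "P \<in> \<S>" "Q \<in> \<S> \<union> \<R>" "P \<noteq> Q" "adj P Q"
  using assms unfolding touching_def by blast

text \<open>Contracting two adjacent blobs \<open>P\<close> and \<open>Q\<close> of
  \<open>\<S>\<close> loses the pair itself and one pair for each common neighbour, at most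
  \<open>1 + 2 = 3\<close>, while \<open>card \<S>\<close> drops by one. When no members of
  \<open>\<S>\<close> are adjacent, only links to \<open>\<R>\<close> remain and
  \<open>links_le\<close> applies.\<close>

lemma touching_le:
  assumes "blobs (\<S> \<union> \<R>)" "\<S> \<inter> \<R> = {}"
  shows "card (touching \<S> \<R>) \<le> 3 * card \<S> + card \<R>"
  using assms
proof (induction "card \<S>" arbitrary: \<S>)
  case 0
  then have "finite \<S>" by (auto simp: blobs_def)
  with 0 have "touching \<S> \<R> = {}" by (auto simp: touching_def)
  then show ?case by simp
next
  case (Suc n)
  have fin: "finite \<R>" "finite \<S>" using Suc.prems(1) by (auto simp: blobs_def)
  have fin_t: "finite (touching \<T> \<R>)" if "finite \<T>" for \<T>
    by (rule finite_subset[of _ "Pow (\<T> \<union> \<R>)"]) (use that fin in \<open>auto simp: touching_def\<close>)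
  show ?case
  proof (cases "\<exists>P\<in>\<S>. \<exists>Q\<in>\<S>. P \<noteq> Q \<and> adj P Q")
    case False
    have "touching \<S> \<R> \<subseteq> (\<lambda>(P, Q). {P, Q}) ` links \<S> \<R>"
    proof
      fix e assume "e \<in> touching \<S> \<R>"
      then obtain P Q where e: "e = {P, Q}" "P \<in> \<S>" "Q \<in> \<S> \<union> \<R>" "P \<noteq> Q" "adj P Q"
        by (rule touchingE)
      then have "(P, Q) \<in> links \<S> \<R>" using False unfolding links_def by blast
      then show "e \<in> (\<lambda>(P, Q). {P, Q}) ` links \<S> \<R>" using e(1) by force
    qed
    then have "card (touching \<S> \<R>) \<le> card (links \<S> \<R>)"
      using surj_card_le[OF finite_links[OF fin(2,1)]] by blast
    then show ?thesis using links_le[OF Suc.prems] by linarith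
  next
    case True
    then obtain P Q where PQ: "P \<in> \<S>" "Q \<in> \<S>" "P \<noteq> Q" "adj P Q" by blast
    define M where "M = P \<union> Q"
    define \<S>' where "\<S>' = insert M (\<S> - {P, Q})"
    have mg: "blobs (insert M (\<S> \<union> \<R> - {P, Q}))" "M \<notin> \<S> \<union> \<R> - {P, Q}"
      using merge_star[OF Suc.prems(1), of P "{Q}"] PQ by (auto simp: M_def)
    have eq: "\<S>' \<union> \<R> = insert M (\<S> \<union> \<R> - {P, Q})"
      using Suc.prems(2) PQ by (auto simp: \<S>'_def)
    have cS: "card \<S> = card \<S>' + 1"
    proof -
      have "card (\<S> - {P, Q}) = card \<S> - 2"
        using PQ fin by (simp add: card_Diff_subset)
      moreover have "2 \<le> card \<S>"
        using card_mono[of \<S> "{P, Q}"] PQ fin by simp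
      moreover have "M \<notin> \<S> - {P, Q}" using mg(2) by blast
      ultimately show ?thesis using fin by (simp add: \<S>'_def)
    qed
    have IH: "card (touching \<S>' \<R>) \<le> 3 * card \<S>' + card \<R>"
    proof (rule Suc.hyps(1))
      show "blobs (\<S>' \<union> \<R>)" using mg eq by simp
      show "\<S>' \<inter> \<R> = {}" using mg(2) Suc.prems(2) PQ by (auto simp: \<S>'_def)
    qed (use cS Suc.hyps(2) in auto)
    define \<C> where "\<C> = {R \<in> \<S> \<union> \<R> - {P, Q}. adj P R \<and> adj Q R}"
    have cC: "card \<C> \<le> 2" "finite \<C>"
      using card_common_le[OF Suc.prems(1), of P Q] PQ fin by (auto simp: \<C>_def)
    \<comment> \<open>For every common neighbour \<open>R\<close> the pair \<open>{Q, R}\<close> is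
      discarded, which makes the contraction injective on the rest.\<close>
    define F where "F = touching \<S> \<R> - insert {P, Q} ((\<lambda>R. {Q, R}) ` \<C>)"
    define f where "f = (\<lambda>R. if R = P \<or> R = Q then M else R)"
    have f_pair: "f ` {p, R} = {M, R}" if "p \<in> {P, Q}" "R \<notin> {P, Q}" for p R
      using that by (auto simp: f_def)
    \<comment> \<open>A kept pair either avoids \<open>P\<close> and \<open>Q\<close> and is fixed
      by \<open>f\<close>, or has exactly one of them as a member and is sent to a pair containing
      \<open>M\<close>. The presence of \<open>M\<close> in the image tells the cases apart.\<close>
    have F_cases: "e \<inter> {P, Q} = {} \<and> M \<notin> e \<and> f ` e = e \<and> e \<in> touching \<S>' \<R> \<or>
        (\<exists>p\<in>{P, Q}. \<exists>R\<in>\<S> \<union> \<R> - {P, Q}. e = {p, R} \<and> adj p R)" if "e \<in> F" for e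
    proof -
      have F: "e \<in> touching \<S> \<R>" "e \<noteq> {P, Q}" using that by (auto simp: F_def)
      obtain A B where "e = {A, B}" "A \<in> \<S>" "B \<in> \<S> \<union> \<R>" "A \<noteq> B" "adj A B"
        using F(1) by (rule touchingE)
      note e = this F(2)
      show ?thesis
      proof (cases "e \<inter> {P, Q} = {}")
        case True
        then have AB: "A \<in> \<S> - {P, Q}" "B \<in> \<S> \<union> \<R> - {P, Q}" using e by auto
        then have "A \<in> \<S>'" "B \<in> \<S>' \<union> \<R>" by (auto simp: \<S>'_def)
        then have "e \<in> touching \<S>' \<R>"
          using touchingI[of A _ B] e by simp
        moreover have "M \<notin> e" using AB e(1) mg(2) by blast
        moreover have "f ` e = e" using AB e(1) by (simp add: f_def)
        ultimately show ?thesis using True by blast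
      next
        case False
        then consider "A \<in> {P, Q}" "B \<notin> {P, Q}" | "B \<in> {P, Q}" "A \<notin> {P, Q}"
          using e by blast
        then show ?thesis
        proof cases
          case 1
          then have "B \<in> \<S> \<union> \<R> - {P, Q}" using e by blast
          with 1 e(1,5) show ?thesis by metis
        next
          case 2
          then have "e = {B, A}" "A \<in> \<S> \<union> \<R> - {P, Q}" "adj B A"
            using e adj_sym by auto
          with 2 show ?thesis by metis
        qed
      qed
    qed
    have f_img: "f ` e \<in> touching \<S>' \<R>" if "e \<in> F" for e
      using F_cases[OF that]
    proof (elim disjE bexE conjE)
      fix p R assume p: "p \<in> {P, Q}" "R \<in> \<S> \<union> \<R> - {P, Q}" "e = {p, R}" "adj p R"
      have "adj M R" using p adj_Un_Union[of P "{Q}" R] by (auto simp: M_def)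
      moreover have "M \<noteq> R" using p mg(2) by blast
      moreover have "R \<in> \<S>' \<union> \<R>" using p by (auto simp: \<S>'_def)
      ultimately have "{M, R} \<in> touching \<S>' \<R>"
        by (intro touchingI) (auto simp: \<S>'_def)
      then show ?thesis using f_pair p by simp
    qed simp
    have f_inj: "inj_on (image f) F"
    proof (rule inj_onI)
      fix e e' assume e: "e \<in> F" "e' \<in> F" "f ` e = f ` e'"
      \<comment> \<open>Two different kept pairs with the same image would join \<open>R\<close> to
        both \<open>P\<close> and \<open>Q\<close>, but then \<open>{Q, R}\<close> was
        discarded.\<close>
      have no: False if "p \<in> {P, Q}" "p' \<in> {P, Q}" "p \<noteq> p'" "R \<in> \<S> \<union> \<R> - {P, Q}"
        "adj p R" "adj p' R" "{p, R} \<in> F" "{p', R} \<in> F" for p p' R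
      proof -
        have "R \<in> \<C>" "{Q, R} \<in> F" using that unfolding \<C>_def by auto
        then show False unfolding F_def by blast
      qed
      have M: "M \<in> f ` {p, R}" if "p \<in> {P, Q}" "R \<in> \<S> \<union> \<R> - {P, Q}" for p R
        using f_pair that by auto
      show "e = e'"
      proof (cases "M \<in> f ` e")
        case True
        obtain p R where p: "p \<in> {P, Q}" "R \<in> \<S> \<union> \<R> - {P, Q}" "e = {p, R}" "adj p R"
          using F_cases[OF e(1)] True by metis
        obtain p' R' where p': "p' \<in> {P, Q}" "R' \<in> \<S> \<union> \<R> - {P, Q}" "e' = {p', R'}" "adj p' R'"
          using F_cases[OF e(2)] True e(3) by metis
        have "{M, R} = {M, R'}" using f_pair p p' e(3) by simp
        moreover have "M \<noteq> R" "M \<noteq> R'" using p p' mg(2) by blast+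
        ultimately have "R = R'" by blast
        then show ?thesis using no[of p p' R] p p' e(1,2) by metis
      next
        case False
        then have "f ` e = e" using F_cases[OF e(1)] M by metis
        moreover have "f ` e' = e'" using False F_cases[OF e(2)] M e(3) by metis
        ultimately show ?thesis using e(3) by metis
      qed
    qed
    have "touching \<S> \<R> \<subseteq> F \<union> insert {P, Q} ((\<lambda>R. {Q, R}) ` \<C>)" by (auto simp: F_def)
    then have "card (touching \<S> \<R>) \<le> card (F \<union> insert {P, Q} ((\<lambda>R. {Q, R}) ` \<C>))"
      using fin_t[OF fin(2)] cC by (intro card_mono) (auto simp: F_def)
    also have "\<dots> \<le> card F + card (insert {P, Q} ((\<lambda>R. {Q, R}) ` \<C>))" by (rule card_Un_le)
    also have "card (insert {P, Q} ((\<lambda>R. {Q, R}) ` \<C>)) \<le> Suc (card ((\<lambda>R. {Q, R}) ` \<C>))"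
      by (rule card_insert_le_m1) auto
    also have "card ((\<lambda>R. {Q, R}) ` \<C>) \<le> card \<C>" by (rule card_image_le[OF cC(2)])
    also have "card F \<le> card (touching \<S>' \<R>)"
    proof (rule card_inj_on_le[OF f_inj])
      show "(`) f ` F \<subseteq> touching \<S>' \<R>" using f_img by blast
      show "finite (touching \<S>' \<R>)" using fin by (intro fin_t) (simp add: \<S>'_def)
    qed
    finally have "card (touching \<S> \<R>) \<le> card (touching \<S>' \<R>) + 3" using cC by linarith
    then show ?thesis using IH cS by linarith
  qed
qed

end

section \<open>Drawings contain no $K_{2,3}$ minor with all vertices on the outer face\<close>

locale graph_drawing =
  fixes G :: "'a graph" and p :: "'a \<Rightarrow> complex" and \<gamma> :: "'a set \<Rightarrow> real \<Rightarrow> complex"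
  assumes simple: "simple_graph G" and planar: "planar_drawing G p \<gamma>"
begin

definition drawn :: "'a set \<Rightarrow> 'a set set \<Rightarrow> complex set" where
  "drawn W F = p ` W \<union> (\<Union>e\<in>F. path_image (\<gamma> e))"

definition subgraph :: "'a set \<Rightarrow> 'a set set \<Rightarrow> bool" where
  "subgraph W F \<longleftrightarrow> W \<subseteq> verts G \<and> F \<subseteq> edges G \<and> \<Union>F \<subseteq> W"

text \<open>Connectedness of the drawn point set rather than of the graph, since it yields arcs in
  the plane directly. \<open>F\<close> may be any selection of edges inside
  \<open>W\<close>.\<close>

definition conn :: "'a set \<Rightarrow> bool" where
  "conn W \<longleftrightarrow> (\<exists>F. subgraph W F \<and> path_connected (drawn W F))"

lemma finite_edges: "finite (edges G)"
  using simple finite_subset[of "edges G" "Pow (verts G)"] by (auto simp: simple_graph_def)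

lemma edgeD:
  assumes "{u, v} \<in> edges G"
  shows "u \<in> verts G" "v \<in> verts G" "u \<noteq> v"
  using assms simple by (auto simp: simple_graph_def)

lemma edge_arc: "e \<in> edges G \<Longrightarrow> arc (\<gamma> e) \<and> p ` e \<subseteq> path_image (\<gamma> e)"
  using planar pathstart_in_path_image[of "\<gamma> e"] pathfinish_in_path_image[of "\<gamma> e"]
  unfolding planar_drawing_def by (metis empty_subsetI insert_subset)

lemma edge_interior:
  assumes "e \<in> edges G" "z \<in> path_image (\<gamma> e)" "z \<notin> p ` e"
  shows "z \<notin> p ` verts G" "f \<in> edges G \<Longrightarrow> z \<in> path_image (\<gamma> f) \<Longrightarrow> f = e"
  using planar assms unfolding planar_drawing_def by blast+

lemma drawn_Un: "drawn (W \<union> W') (F \<union> F') = drawn W F \<union> drawn W' F'"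
  by (auto simp: drawn_def)

lemma drawn_mono: "W \<subseteq> W' \<Longrightarrow> F \<subseteq> F' \<Longrightarrow> drawn W F \<subseteq> drawn W' F'"
  by (auto simp: drawn_def)

text \<open>Planarity in set form: an interior point of an edge lies on no other edge and is no
  vertex, and distinct vertices have distinct points, so a common point comes from a common edge or
  a common vertex.\<close>

lemma drawn_Int:
  assumes "subgraph W F" "subgraph W' F'"
  shows "drawn W F \<inter> drawn W' F' \<subseteq> drawn (W \<inter> W') (F \<inter> F')"
proof
  fix z assume z: "z \<in> drawn W F \<inter> drawn W' F'"
  have cases: "z \<in> p ` W \<or> (\<exists>e\<in>F. z \<in> path_image (\<gamma> e) \<and> z \<notin> p ` e)"
    if "z \<in> drawn W F" "subgraph W F" for W F
    using that unfolding drawn_def subgraph_def by blast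
  have inj: "inj_on p (verts G)" using planar by (simp add: planar_drawing_def)
  show "z \<in> drawn (W \<inter> W') (F \<inter> F')"
  proof (cases "\<exists>e\<in>F. z \<in> path_image (\<gamma> e) \<and> z \<notin> p ` e")
    case True
    then obtain e where e: "e \<in> F" "e \<in> edges G" "z \<in> path_image (\<gamma> e)" "z \<notin> p ` e"
      using assms by (auto simp: subgraph_def)
    have "z \<notin> p ` W'" using edge_interior(1)[OF e(2-4)] assms by (auto simp: subgraph_def)
    then obtain f where f: "f \<in> F'" "z \<in> path_image (\<gamma> f)" using z by (auto simp: drawn_def)
    moreover have "f \<in> edges G" using f assms by (auto simp: subgraph_def)
    ultimately have "f = e" using edge_interior(2)[OF e(2-4)] by blast
    then show ?thesis using e f by (auto simp: drawn_def)
  next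
    case False
    then obtain v where v: "v \<in> W" "z = p v" using cases[of W F] z assms by blast
    then have "v \<in> verts G" using assms by (auto simp: subgraph_def)
    have "z \<in> p ` W'"
      using cases[of W' F'] z assms edge_interior(1)[of _ z] v \<open>v \<in> verts G\<close>
      unfolding subgraph_def by blast
    then obtain w where "w \<in> W'" "p w = p v" using v by auto
    moreover have "w = v"
      using inj_onD[OF inj calculation(2)] \<open>w \<in> W'\<close> \<open>v \<in> verts G\<close> assms by (auto simp: subgraph_def)
    ultimately show ?thesis using v by (auto simp: drawn_def)
  qed
qed

lemma closed_drawn: "subgraph W F \<Longrightarrow> closed (drawn W F)"
proof -
  assume W: "subgraph W F"
  then have "finite W" "finite F"
    using simple finite_subset[of W "verts G"] finite_subset[OF _ finite_edges, of F]
    by (simp_all add: subgraph_def simple_graph_def)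
  moreover have "closed (path_image (\<gamma> e))" if "e \<in> F" for e
    using that W edge_arc closed_arc_image unfolding subgraph_def by blast
  ultimately show ?thesis
    unfolding drawn_def by (simp add: closed_Un closed_UN finite_imp_closed)
qed

lemma drawn_edge:
  assumes "{u, v} \<in> edges G"
  shows "subgraph {u, v} {{u, v}}" "path_connected (drawn {u, v} {{u, v}})"
proof -
  show "subgraph {u, v} {{u, v}}" using assms edgeD by (auto simp: subgraph_def)
  have "drawn {u, v} {{u, v}} = path_image (\<gamma> {u, v})"
    using edge_arc[OF assms] by (auto simp: drawn_def)
  then show "path_connected (drawn {u, v} {{u, v}})"
    using edge_arc[OF assms] arc_imp_path path_connected_path_image by metis
qed

lemma subgraph_Un: "subgraph W F \<Longrightarrow> subgraph W' F' \<Longrightarrow> subgraph (W \<union> W') (F \<union> F')"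
  by (auto simp: subgraph_def)

lemma path_connected_drawn_Un:
  assumes "path_connected (drawn W F)" "path_connected (drawn W' F')" "v \<in> W" "v \<in> W'"
  shows "path_connected (drawn (W \<union> W') (F \<union> F'))"
  unfolding drawn_Un using assms by (intro path_connected_Un) (auto simp: drawn_def)

lemma conn_singleton: "v \<in> verts G \<Longrightarrow> conn {v}"
  unfolding conn_def by (rule exI[of _ "{}"]) (auto simp: subgraph_def drawn_def)

lemma conn_Un:
  assumes "conn A" "conn B" "adjacent (edges G) A B"
  shows "conn (A \<union> B)"
proof -
  obtain F F' where F: "subgraph A F" "path_connected (drawn A F)"
    "subgraph B F'" "path_connected (drawn B F')"
    using assms unfolding conn_def by blast
  obtain u v where uv: "u \<in> A" "v \<in> B" "{u, v} \<in> edges G"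
    using assms unfolding adjacent_def by blast
  have "subgraph (A \<union> {u, v} \<union> B) (F \<union> {{u, v}} \<union> F')"
    using F drawn_edge[OF uv(3)] by (intro subgraph_Un)
  moreover have "path_connected (drawn (A \<union> {u, v} \<union> B) (F \<union> {{u, v}} \<union> F'))"
    by (intro path_connected_drawn_Un[of _ _ _ _ v] path_connected_drawn_Un[of _ _ _ _ u])
      (use F uv drawn_edge in auto)
  moreover have "A \<union> {u, v} \<union> B = A \<union> B" using uv by auto
  ultimately show ?thesis unfolding conn_def by metis
qed

lemma point_notin_drawn:
  assumes "subgraph W F" "v \<in> verts G" "v \<notin> W"
  shows "p v \<notin> drawn W F"
proof
  assume "p v \<in> drawn W F"
  then have "p v \<in> drawn W F \<inter> drawn {v} {}" by (simp add: drawn_def)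
  also have "\<dots> \<subseteq> drawn (W \<inter> {v}) (F \<inter> {})"
    using assms by (intro drawn_Int) (auto simp: subgraph_def)
  finally show False using assms by (simp add: drawn_def)
qed

lemma edge_nonempty: "subgraph W F \<Longrightarrow> e \<in> F \<Longrightarrow> e \<noteq> {} \<and> e \<subseteq> W"
  using simple by (fastforce simp: subgraph_def simple_graph_def)

text \<open>An edge shared by two limbs would have its ends in \<open>U i \<inter> U j\<close>,
  hence inside \<open>W\<close>, which hypothesis \<open>H\<close> excludes. So limbs share only
  vertices, and these lie in \<open>W\<close>.\<close>

lemma forked_drawn:
  assumes D: "subgraph W F" "path_connected (drawn W F)"
    and E: "\<And>i. i \<in> {1, 2, 3} \<Longrightarrow> subgraph (U i) (H i) \<and> path_connected (drawn (U i) (H i))"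
    and meet: "\<And>i. i \<in> {1, 2, 3} \<Longrightarrow> W \<inter> U i \<noteq> {}"
    and disj: "\<And>i j. i \<in> {1, 2, 3} \<Longrightarrow> j \<in> {1, 2, 3} \<Longrightarrow> i \<noteq> j \<Longrightarrow> U i \<inter> U j \<subseteq> W"
    and H: "\<And>i e. i \<in> {1, 2, 3} \<Longrightarrow> e \<in> H i \<Longrightarrow> \<not> e \<subseteq> W"
    and x: "\<And>i. i \<in> {1, 2, 3} \<Longrightarrow> x i \<in> U i - W"
  shows "forked (drawn W F) (drawn (U 1) (H 1)) (drawn (U 2) (H 2)) (drawn (U (3::nat)) (H 3))
    (p (x 1)) (p (x 2)) (p (x 3))"
proof -
  have cl: "closed (drawn (U i) (H i)) \<and> path_connected (drawn (U i) (H i))" if "i \<in> {1, 2, 3}" for i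
    using E[OF that] closed_drawn by blast
  have mt: "drawn W F \<inter> drawn (U i) (H i) \<noteq> {}" if "i \<in> {1, 2, 3}" for i
    using meet[OF that] by (auto simp: drawn_def)
  have dj: "drawn (U i) (H i) \<inter> drawn (U j) (H j) \<subseteq> drawn W F"
    if "i \<in> {1, 2, 3}" "j \<in> {1, 2, 3}" "i \<noteq> j" for i j
  proof -
    have "H i \<inter> H j = {}"
      using disj[OF that] H[OF that(1)] E[OF that(1)] E[OF that(2)] unfolding subgraph_def by blast
    then have "drawn (U i) (H i) \<inter> drawn (U j) (H j) \<subseteq> drawn (U i \<inter> U j) {}"
      using drawn_Int E that by metis
    also have "\<dots> \<subseteq> drawn W F" using disj[OF that] by (intro drawn_mono) auto
    finally show ?thesis .
  qed
  have xx: "p (x i) \<in> drawn (U i) (H i) - drawn W F" if "i \<in> {1, 2, 3}" for i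
    using x[OF that] E[OF that] point_notin_drawn[OF D(1), of "x i"]
    by (auto simp: drawn_def subgraph_def)
  show ?thesis
    unfolding forked_def
    using cl[of 1] cl[of 2] cl[of 3] mt[of 1] mt[of 2] mt[of 3] dj[of 1 2] dj[of 1 3] dj[of 2 3]
      xx[of 1] xx[of 2] xx[of 3] D closed_drawn[OF D(1)]
    by simp
qed

text \<open>\<open>A\<close> and \<open>B\<close> are the bodies of two tripods that share their
  tips, one vertex \<open>x i\<close> in each of the other three branch sets. All tips reach the
  outer face because every vertex does, so \<open>two_tripods\<close> gives the
  contradiction.\<close>

lemma no_K23:
  assumes outer: "\<And>v. v \<in> verts G \<Longrightarrow> p v \<in> frontier (outer_face G p \<gamma>)"
    and conn: "\<And>P. P \<in> {A, B, X, Y, Z} \<Longrightarrow> conn P"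
    and disj: "pairwise disjnt {A, B, X, Y, Z}" "distinct [A, B, X, Y, Z]"
    and adj: "\<And>P. P \<in> {X, Y, Z} \<Longrightarrow> adjacent (edges G) A P \<and> adjacent (edges G) B P"
  shows False
proof -
  define X' where "X' = (\<lambda>i::nat. if i = 1 then X else if i = 2 then Y else Z)"
  define N where "N = {1, 2, 3::nat}"
  have X': "X' i \<in> {X, Y, Z}" for i by (simp add: X'_def)
  have pw: "P \<inter> Q = {}" if "P \<in> {A, B, X, Y, Z}" "Q \<in> {A, B, X, Y, Z}" "P \<noteq> Q" for P Q
    using pairwiseD[OF disj(1) that] by (simp add: disjnt_def)
  have dAB: "A \<inter> B = {}" using disj(2) by (intro pw) auto
  have dAX: "A \<inter> X' i = {}" "B \<inter> X' i = {}" for i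
    using disj(2) by (intro pw; auto simp: X'_def)+
  have dX: "X' i \<inter> X' j = {}" if "i \<in> N" "j \<in> N" "i \<noteq> j" for i j
  proof (rule pw)
    show "X' i \<noteq> X' j"
      using that disj(2) unfolding N_def X'_def by (elim insertE) (simp_all add: eq_commute)
  qed (simp_all add: X'_def)
  have adj': "adjacent (edges G) A (X' i)" "adjacent (edges G) B (X' i)" for i
    using adj[OF X'[of i]] by simp_all
  have "\<exists>a x. a \<in> A \<and> x \<in> X' i \<and> {a, x} \<in> edges G" for i
    using adj'(1)[of i] by (auto simp: adjacent_def)
  then obtain a x where a: "\<And>i. a i \<in> A" "\<And>i. x i \<in> X' i" "\<And>i. {a i, x i} \<in> edges G"
    by metis
  have "\<exists>b y. b \<in> B \<and> y \<in> X' i \<and> {b, y} \<in> edges G" for i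
    using adj'(2)[of i] by (auto simp: adjacent_def)
  then obtain b y where b: "\<And>i. b i \<in> B" "\<And>i. y i \<in> X' i" "\<And>i. {b i, y i} \<in> edges G"
    by metis
  obtain FA where FA: "subgraph A FA" "path_connected (drawn A FA)"
    using conn[of A] by (auto simp: conn_def)
  obtain FB where FB: "subgraph B FB" "path_connected (drawn B FB)"
    using conn[of B] by (auto simp: conn_def)
  have "\<exists>F. subgraph (X' i) F \<and> path_connected (drawn (X' i) F)" for i
    using conn[of "X' i"] X'[of i] by (auto simp: conn_def)
  then obtain F where F: "\<And>i. subgraph (X' i) (F i)" "\<And>i. path_connected (drawn (X' i) (F i))"
    by metis
  define U where "U = (\<lambda>i. {a i, x i})"
  define H where "H = (\<lambda>i. {{a i, x i}})"
  \<comment> \<open>The edge from \<open>B\<close> may end at a vertex \<open>y i\<close> different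
    from \<open>x i\<close>, so on this side the limb includes the whole branch set to reach the
    tip.\<close>
  define U' where "U' = (\<lambda>i. {b i, y i} \<union> X' i)"
  define H' where "H' = (\<lambda>i. {{b i, y i}} \<union> F i)"
  have E: "subgraph (U i) (H i)" "path_connected (drawn (U i) (H i))" for i
    unfolding U_def H_def using drawn_edge[OF a(3)] by auto
  have E': "subgraph (U' i) (H' i)" "path_connected (drawn (U' i) (H' i))" for i
    unfolding U'_def H'_def
    by (intro subgraph_Un drawn_edge b F)
      (intro path_connected_drawn_Un[of _ _ _ _ "y i"] drawn_edge b F; use b in simp)
  have nA: "x i \<notin> A" "x i \<notin> B" "y i \<notin> B" "y i \<notin> A" for i
    using a(2)[of i] b(2)[of i] dAX[of i] by blast+
  have f1: "forked (drawn A FA) (drawn (U 1) (H 1)) (drawn (U 2) (H 2)) (drawn (U 3) (H 3))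
      (p (x 1)) (p (x 2)) (p (x 3))"
  proof (rule forked_drawn[OF FA])
    fix i j :: nat assume ij: "i \<in> {1, 2, 3}" "j \<in> {1, 2, 3}" "i \<noteq> j"
    then have "x i \<noteq> x j" using dX[of i j] a(2)[of i] a(2)[of j] by (auto simp: N_def)
    then show "U i \<inter> U j \<subseteq> A" using a(1) by (auto simp: U_def)
  next
    show "A \<inter> U i \<noteq> {}" "x i \<in> U i - A" for i
      using a(1)[of i] nA by (auto simp: U_def)
    show "\<not> e \<subseteq> A" if "e \<in> H i" for i e
      using that nA by (auto simp: H_def)
  qed (simp add: E)
  have f2: "forked (drawn B FB) (drawn (U' 1) (H' 1)) (drawn (U' 2) (H' 2)) (drawn (U' 3) (H' 3))
      (p (x 1)) (p (x 2)) (p (x 3))"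
  proof (rule forked_drawn[OF FB])
    fix i j :: nat assume ij: "i \<in> {1, 2, 3}" "j \<in> {1, 2, 3}" "i \<noteq> j"
    then have "X' i \<inter> X' j = {}" using dX by (simp add: N_def)
    moreover have "U' k = insert (b k) (X' k)" for k using b(2) by (auto simp: U'_def)
    ultimately show "U' i \<inter> U' j \<subseteq> B" using b(1)[of i] b(1)[of j] by auto
  next
    fix i :: nat and e assume "e \<in> H' i"
    then have "e = {b i, y i} \<or> e \<subseteq> X' i \<and> e \<noteq> {}"
      using edge_nonempty[OF F(1)] by (auto simp: H'_def)
    then show "\<not> e \<subseteq> B" using nA(3) dAX(2)[of i] by blast
  next
    show "B \<inter> U' i \<noteq> {}" "x i \<in> U' i - B" for i
      using a(2)[of i] b(1)[of i] nA by (auto simp: U'_def)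
  qed (simp add: E')
  define S where "S = A \<union> U 1 \<union> U 2 \<union> U 3"
  define K where "K = FA \<union> H 1 \<union> H 2 \<union> H 3"
  define S' where "S' = B \<union> U' 1 \<union> U' 2 \<union> U' 3"
  define K' where "K' = FB \<union> H' 1 \<union> H' 2 \<union> H' 3"
  have S: "subgraph S K" "subgraph S' K'"
    unfolding S_def K_def S'_def K'_def by (intro subgraph_Un FA FB E E')+
  have dr: "drawn A FA \<union> drawn (U 1) (H 1) \<union> drawn (U 2) (H 2) \<union> drawn (U 3) (H 3) = drawn S K"
    "drawn B FB \<union> drawn (U' 1) (H' 1) \<union> drawn (U' 2) (H' 2) \<union> drawn (U' 3) (H' 3) = drawn S' K'"
    by (simp_all add: S_def K_def S'_def K'_def drawn_Un)
  have S'_sub: "S' \<subseteq> B \<union> X' 1 \<union> X' 2 \<union> X' 3" using b by (auto simp: S'_def U'_def)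
  have AS': "A \<inter> S' = {}" using S'_sub dAB dAX by blast
  \<comment> \<open>Each edge of \<open>K\<close> has an end in \<open>A\<close>, while each edge of
    \<open>K'\<close> lies within \<open>S'\<close>, which misses \<open>A\<close>.\<close>
  have "K \<inter> K' = {}"
  proof -
    have "e \<inter> A \<noteq> {}" if "e \<in> K" for e
      using that edge_nonempty[OF FA(1), of e] a(1) by (auto simp: K_def H_def)
    moreover have "e \<inter> A = {}" if "e \<in> K'" for e
      using that S(2) AS' unfolding subgraph_def by blast
    ultimately show ?thesis by blast
  qed
  moreover have "S \<inter> S' \<subseteq> {x 1, x 2, x 3}"
    using AS' a(1) by (auto simp: S_def U_def)
  ultimately have meet: "drawn S K \<inter> drawn S' K' \<subseteq> {p (x 1), p (x 2), p (x 3)}"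
    using drawn_Int[OF S] drawn_mono[of "S \<inter> S'" "{x 1, x 2, x 3}" "{}" "{}"]
    by (auto simp: drawn_def)
  \<comment> \<open>A part of the drawing has a larger outside, so the tips remain in the closure of
    the outside.\<close>
  have "drawn S K \<union> drawn S' K' \<subseteq> drawing_points G p \<gamma>"
    using drawn_mono[of S "verts G" K "edges G"] drawn_mono[of S' "verts G" K' "edges G"] S
    by (simp add: subgraph_def drawing_points_def drawn_def[of "verts G"])
  then have "closure (outer_face G p \<gamma>) \<subseteq> closure (outside (drawn S K \<union> drawn S' K'))"
    unfolding outer_face_def by (intro closure_mono outside_mono)
  moreover have "p (x i) \<in> closure (outer_face G p \<gamma>)" for i
    using outer[of "x i"] edgeD[OF a(3)] by (auto simp: frontier_def)
  ultimately have "{p (x 1), p (x 2), p (x 3)} \<subseteq> closure (outside (drawn S K \<union> drawn S' K'))"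
    by blast
  then show False using two_tripods[OF f1 f2] meet unfolding dr by blast
qed

end

section \<open>Deleting vertices of large degree\<close>

definition crossing :: "'a set set \<Rightarrow> 'a set \<Rightarrow> 'a set \<Rightarrow> 'a set set" where
  "crossing E U S = {e \<in> E. e \<subseteq> U \<and> e \<inter> S \<noteq> {}}"

context K23_minor_free begin

text \<open>Vertices enter the minor bounds as singleton blobs. For independent \<open>S\<close>
  every crossing edge leads to \<open>U - S\<close>, so the sharper bound for links is
  available.\<close>

lemma
  assumes fin: "finite U" and S: "S \<subseteq> U" and E: "\<And>e. e \<in> E \<Longrightarrow> card e = 2"
    and single: "\<And>v. v \<in> U \<Longrightarrow> conn {v}"
  shows crossing_le: "card (crossing E U S) \<le> 3 * card S + card (U - S)"
    and crossing_independent_le: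
      "(\<And>e. e \<in> E \<Longrightarrow> \<not> e \<subseteq> S) \<Longrightarrow> card (crossing E U S) \<le> 2 * card S + card (U - S)"
proof -
  define sg :: "'a \<Rightarrow> 'a set" where "sg = (\<lambda>v. {v})"
  have bl: "blobs (sg ` S \<union> sg ` (U - S))" "sg ` S \<inter> sg ` (U - S) = {}"
    using fin S single finite_subset[OF S] by (auto simp: blobs_def sg_def pairwise_def)
  have c: "card (sg ` S) = card S" "card (sg ` (U - S)) = card (U - S)"
    by (simp_all add: card_image sg_def)
  have ends: "\<exists>v x. e = {v, x} \<and> v \<in> S \<and> x \<in> U \<and> v \<noteq> x" if e: "e \<in> crossing E U S" for e
  proof -
    obtain v where v: "v \<in> e" "v \<in> S" using e by (auto simp: crossing_def)
    obtain a b where ab: "e = {a, b}" "a \<noteq> b"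
      using E[of e] e by (auto simp: crossing_def card_2_iff)
    then obtain x where x: "e = {v, x}" "v \<noteq> x" using v(1) by auto
    then show ?thesis using v e by (auto simp: crossing_def)
  qed
  have fin_sg: "finite (sg ` S)" "finite (sg ` (U - S))"
    using fin finite_subset[OF S] by simp_all
  have "crossing E U S \<subseteq> Union ` touching (sg ` S) (sg ` (U - S))"
  proof
    fix e assume e: "e \<in> crossing E U S"
    then obtain v x where vx: "e = {v, x}" "v \<in> S" "x \<in> U" "v \<noteq> x" using ends by blast
    have "{sg v, sg x} \<in> touching (sg ` S) (sg ` (U - S))"
      by (rule touchingI) (use vx e in \<open>auto simp: sg_def adjacent_def crossing_def\<close>)
    moreover have "e = \<Union>{sg v, sg x}" using vx by (auto simp: sg_def)
    ultimately show "e \<in> Union ` touching (sg ` S) (sg ` (U - S))" by blast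
  qed
  moreover have "finite (touching (sg ` S) (sg ` (U - S)))"
    by (rule finite_subset[of _ "Pow (sg ` S \<union> sg ` (U - S))"])
      (use fin_sg in \<open>auto elim!: touchingE\<close>)
  ultimately have "card (crossing E U S) \<le> card (touching (sg ` S) (sg ` (U - S)))"
    using surj_card_le by blast
  then show "card (crossing E U S) \<le> 3 * card S + card (U - S)"
    using touching_le[OF bl] c by linarith
  assume indep: "\<And>e. e \<in> E \<Longrightarrow> \<not> e \<subseteq> S"
  have "crossing E U S \<subseteq> (\<lambda>(P, Q). P \<union> Q) ` links (sg ` S) (sg ` (U - S))"
  proof
    fix e assume e: "e \<in> crossing E U S"
    then obtain v x where vx: "e = {v, x}" "v \<in> S" "x \<in> U" "v \<noteq> x" using ends by blast
    have "x \<notin> S" using indep[of e] e vx by (auto simp: crossing_def)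
    then have "(sg v, sg x) \<in> links (sg ` S) (sg ` (U - S))"
      using vx e by (auto simp: sg_def adjacent_def crossing_def links_def)
    moreover have "e = (\<lambda>(P, Q). P \<union> Q) (sg v, sg x)" using vx by (auto simp: sg_def)
    ultimately show "e \<in> (\<lambda>(P, Q). P \<union> Q) ` links (sg ` S) (sg ` (U - S))" by (rule rev_image_eqI)
  qed
  then have "card (crossing E U S) \<le> card (links (sg ` S) (sg ` (U - S)))"
    using surj_card_le[OF finite_links[OF fin_sg]] by blast
  then show "card (crossing E U S) \<le> 2 * card S + card (U - S)"
    using links_le[OF bl] c by linarith
qed

end

definition deg_in :: "'a set set \<Rightarrow> 'a set \<Rightarrow> 'a \<Rightarrow> nat" where
  "deg_in E U v = card {e \<in> E. e \<subseteq> U \<and> v \<in> e}"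

text \<open>A vertex is deleted only while its current degree exceeds \<open>k\<close>, so each
  deletion destroys at least \<open>k + 1\<close> edges, and no edge is destroyed twice.\<close>

lemma greedy_deletion:
  assumes "finite E" "finite U"
  shows "\<exists>S\<subseteq>U. (\<forall>v\<in>U - S. deg_in E (U - S) v \<le> k) \<and> (k + 1) * card S \<le> card (crossing E U S)"
  using assms(2)
proof (induction "card U" arbitrary: U)
  case 0
  then show ?case by (intro exI[of _ "{}"]) auto
next
  case (Suc n)
  show ?case
  proof (cases "\<exists>v\<in>U. deg_in E U v > k")
    case False
    then show ?thesis by (intro exI[of _ "{}"]) (auto simp: not_less)
  next
    case True
    then obtain v where v: "v \<in> U" "deg_in E U v > k" by blast
    obtain S where S: "S \<subseteq> U - {v}" "\<forall>w\<in>U - {v} - S. deg_in E (U - {v} - S) w \<le> k"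
      "(k + 1) * card S \<le> card (crossing E (U - {v}) S)"
    proof -
      have "n = card (U - {v})" "finite (U - {v})" using Suc.hyps(2) Suc.prems v(1) by simp_all
      from Suc.hyps(1)[OF this] show thesis using that by blast
    qed
    have finS: "finite S" using S(1) Suc.prems finite_subset by blast
    have fin: "finite (crossing E (U - {v}) S)" "finite {e \<in> E. e \<subseteq> U \<and> v \<in> e}"
      "finite (crossing E U (insert v S))"
      using assms(1) by (auto simp: crossing_def)
    have "(k + 1) * card (insert v S) = (k + 1) * card S + (k + 1)"
      using finS S(1) by (subst card_insert_disjoint) auto
    also have "\<dots> \<le> card (crossing E (U - {v}) S) + deg_in E U v"
      using S(3) v(2) by linarith
    also have "\<dots> = card (crossing E (U - {v}) S \<union> {e \<in> E. e \<subseteq> U \<and> v \<in> e})"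
      unfolding deg_in_def using fin by (intro card_Un_disjoint[symmetric]) (auto simp: crossing_def)
    also have "\<dots> \<le> card (crossing E U (insert v S))"
      using fin(3) by (intro card_mono) (auto simp: crossing_def)
    finally have "(k + 1) * card (insert v S) \<le> card (crossing E U (insert v S))" .
    moreover have "U - insert v S = U - {v} - S" by blast
    ultimately show ?thesis using S v(1) by (intro exI[of _ "insert v S"]) auto
  qed
qed

text \<open>Deleting a maximal independent set of vertices of degree \<open>k + 1\<close> suffices: every other vertex of
  that degree loses a neighbour.\<close>

lemma independent_deletion:
  assumes finE: "finite E" and finU: "finite U" and two: "\<And>e. e \<in> E \<Longrightarrow> card e = 2"
    and deg: "\<And>v. v \<in> U \<Longrightarrow> deg_in E U v \<le> k + 1"
  shows "\<exists>S\<subseteq>U. (\<forall>v\<in>U - S. deg_in E (U - S) v \<le> k) \<and> (\<forall>e\<in>E. \<not> e \<subseteq> S) \<and>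
    card (crossing E U S) = (k + 1) * card S"
proof -
  define \<I> where "\<I> = {S. S \<subseteq> {v \<in> U. deg_in E U v = k + 1} \<and> (\<forall>e\<in>E. \<not> e \<subseteq> S)}"
  have fin: "finite \<I>"
    by (rule finite_subset[of _ "Pow U"]) (use finU in \<open>auto simp: \<I>_def\<close>)
  have "{} \<in> \<I>" using two by (fastforce simp: \<I>_def)
  then obtain S where S: "S \<in> \<I>" "\<And>T. T \<in> \<I> \<Longrightarrow> S \<subseteq> T \<Longrightarrow> T = S"
    using finite_has_maximal[OF fin] by blast
  have SU: "S \<subseteq> U" and Sdeg: "\<And>v. v \<in> S \<Longrightarrow> deg_in E U v = k + 1"
    and indep: "\<And>e. e \<in> E \<Longrightarrow> \<not> e \<subseteq> S"
    using S(1) by (auto simp: \<I>_def)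
  have finS: "finite S" using SU finU finite_subset by blast
  have "deg_in E (U - S) v \<le> k" if v: "v \<in> U - S" for v
  proof -
    have sub: "{e \<in> E. e \<subseteq> U - S \<and> v \<in> e} \<subseteq> {e \<in> E. e \<subseteq> U \<and> v \<in> e}" by blast
    show ?thesis
    proof (cases "deg_in E U v = k + 1")
      case False
      then have "deg_in E U v \<le> k" using deg[of v] v by simp
      then show ?thesis
        using card_mono[OF _ sub] finE unfolding deg_in_def by simp
    next
      case True
      \<comment> \<open>By maximality, \<open>insert v S\<close> contains an edge; it passes through
        \<open>v\<close> since \<open>S\<close> is independent, and its other end lies in
        \<open>S\<close>. Deleting \<open>S\<close> thus lowers the degree of
        \<open>v\<close>.\<close>
      have "insert v S \<notin> \<I>" using S(2)[of "insert v S"] v by blast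
      then obtain e where e: "e \<in> E" "e \<subseteq> insert v S"
        using S(1) True v by (auto simp: \<I>_def)
      then have "v \<in> e" using indep by blast
      moreover have "e \<noteq> {v}" using two[OF e(1)] by auto
      then have "e \<inter> S \<noteq> {}" using e \<open>v \<in> e\<close> by blast
      moreover have "e \<subseteq> U" using e(2) v SU by blast
      ultimately have "{e \<in> E. e \<subseteq> U - S \<and> v \<in> e} \<subset> {e \<in> E. e \<subseteq> U \<and> v \<in> e}"
        using e(1) by blast
      then have "deg_in E (U - S) v < deg_in E U v"
        unfolding deg_in_def using finE by (intro psubset_card_mono) auto
      then show ?thesis using True by simp
    qed
  qed
  moreover have "card (crossing E U S) = (k + 1) * card S"
  proof -
    \<comment> \<open>The crossing edges split into the stars at the members of \<open>S\<close>; an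
      edge in two stars would join two members of \<open>S\<close>.\<close>
    have "crossing E U S = (\<Union>v\<in>S. {e \<in> E. e \<subseteq> U \<and> v \<in> e})"
      by (auto simp: crossing_def)
    moreover have "{e \<in> E. e \<subseteq> U \<and> v \<in> e} \<inter> {e \<in> E. e \<subseteq> U \<and> w \<in> e} = {}"
      if vw: "v \<in> S" "w \<in> S" "v \<noteq> w" for v w
    proof -
      have False if "e \<in> E" "v \<in> e" "w \<in> e" for e
      proof -
        have "card e = 2" using two that by blast
        moreover have "finite e" by (rule card_ge_0_finite) (use \<open>card e = 2\<close> in simp)
        ultimately have "e = {v, w}"
          using card_subset_eq[of e "{v, w}"] that vw(3) by auto
        then show False using indep[OF that(1)] vw by blast
      qed
      then show ?thesis by blast
    qed
    ultimately have "card (crossing E U S) = (\<Sum>v\<in>S. deg_in E U v)"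
      unfolding deg_in_def using finS finE by (simp add: card_UN_disjoint)
    then show ?thesis using Sdeg by simp
  qed
  ultimately show ?thesis using SU indep by blast
qed

section \<open>Application to outerplanar graphs\<close>

lemma outerplanar_K23_minor_free:
  assumes "outerplanar G"
  obtains conn where "K23_minor_free (edges G) conn" "\<And>v. v \<in> verts G \<Longrightarrow> conn {v}"
proof -
  obtain p \<gamma> where d: "simple_graph G" "planar_drawing G p \<gamma>"
    "\<And>v. v \<in> verts G \<Longrightarrow> p v \<in> frontier (outer_face G p \<gamma>)"
    using assms unfolding outerplanar_def by blast
  interpret graph_drawing G p \<gamma> using d by unfold_locales
  have "K23_minor_free (edges G) conn"
  proof
    show "conn (A \<union> B)" if "conn A" "conn B" "adjacent (edges G) A B" for A B
      using that by (rule conn_Un)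
    show False
      if "\<And>P. P \<in> {A, B, X, Y, Z} \<Longrightarrow> conn P" "pairwise disjnt {A, B, X, Y, Z}"
        "distinct [A, B, X, Y, Z]"
        "\<And>P. P \<in> {X, Y, Z} \<Longrightarrow> adjacent (edges G) A P \<and> adjacent (edges G) B P"
      for A B X Y Z
      using d(3) that by (rule no_K23)
  qed
  then show thesis using that conn_singleton by blast
qed

lemma max_degree_induced_le:
  assumes "finite I" "\<And>v. v \<in> I \<Longrightarrow> deg_in (edges G) I v \<le> k"
  shows "max_degree (induced_subgraph G I) \<le> k"
proof -
  have "degree (induced_subgraph G I) v = deg_in (edges G) I v" for v
    by (simp add: degree_def induced_subgraph_def deg_in_def conj_assoc)
  then show ?thesis
    using assms by (auto simp: max_degree_def induced_subgraph_def)
qed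

text \<open>Both ratios of the theorem have the form \<open>c / (c + 4)\<close>, with
  \<open>c\<close> equal to \<open>2k + 1\<close> or \<open>2k + 2/3\<close>. For \<open>r\<close>
  kept and \<open>s\<close> deleted vertices the claim becomes linear.\<close>

lemma ratio_le:
  fixes c r s :: real
  assumes "c > 0" "c * s \<le> 4 * r"
  shows "c / (c + 4) * (r + s) \<le> r"
  using assms by (simp add: field_simps)

theorem theorem6:
  fixes G :: "'a graph" and n k :: nat
  assumes "n \<ge> 1"
    and "outerplanar G"
    and "card (verts G) = n"
    and "k \<ge> 4"
  shows "\<exists>I. I \<subseteq> verts G \<and> max_degree (induced_subgraph G I) \<le> k \<and>
    (even k \<longrightarrow> real (card I) \<ge> (2 * real k + 1) / (2 * real k + 5) * real n) \<and>
    (odd k \<longrightarrow> real (card I) \<ge> (2 * real k + 2 / 3) / (2 * real k + 14 / 3) * real n)"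
proof -
  define V where "V = verts G"
  define E where "E = edges G"
  have simple: "simple_graph G" using assms(2) by (simp add: outerplanar_def)
  have finV: "finite V" using simple by (simp add: simple_graph_def V_def)
  have E: "\<And>e. e \<in> E \<Longrightarrow> e \<subseteq> V" "\<And>e. e \<in> E \<Longrightarrow> card e = 2"
    using simple by (auto simp: simple_graph_def V_def E_def)
  have finE: "finite E" using E(1) finV by (meson PowI finite_Pow_iff finite_subset subsetI)
  obtain conn where conn: "K23_minor_free E conn" "\<And>v. v \<in> V \<Longrightarrow> conn {v}"
    using outerplanar_K23_minor_free[OF assms(2)] unfolding V_def E_def by blast
  interpret K23_minor_free E conn by (rule conn(1))
  \<comment> \<open>For \<open>k = 4\<close> the general inequality would give only
    \<open>8 * card S \<le> 4 * card (V - S)\<close>, whereas the ratio \<open>9 / 13\<close> asks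
    for the factor 9.\<close>
  have "\<exists>S\<subseteq>V. (\<forall>v\<in>V - S. deg_in E (V - S) v \<le> k) \<and>
      (if k = 4 then 9 * card S \<le> 4 * card (V - S) else (k - 2) * card S \<le> card (V - S))"
  proof (cases "k = 4")
    case False
    obtain S where S: "S \<subseteq> V" "\<forall>v\<in>V - S. deg_in E (V - S) v \<le> k"
      "(k + 1) * card S \<le> card (crossing E V S)"
      using greedy_deletion[OF finE finV, of k] by blast
    have "(k + 1) * card S \<le> 3 * card S + card (V - S)"
      using S(3) crossing_le[OF finV S(1) E(2) conn(2)] by linarith
    moreover have "(k + 1) * card S = (k - 2) * card S + 3 * card S"
      using assms(4) by (simp add: algebra_simps flip: add_mult_distrib)
    ultimately show ?thesis using S False by (intro exI[of _ S]) simp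
  next
    case True
    \<comment> \<open>Stopping at degree 5 rather than 4 prepares for
      \<open>independent_deletion\<close>, whose degree hypothesis then holds on the rest with
      \<open>k = 4\<close>.\<close>
    obtain S where S: "S \<subseteq> V" "\<forall>v\<in>V - S. deg_in E (V - S) v \<le> 5"
      "(5 + 1) * card S \<le> card (crossing E V S)"
      using greedy_deletion[OF finE finV, of 5] by blast
    define U where "U = V - S"
    have finU: "finite U" using finV by (simp add: U_def)
    obtain T where T: "T \<subseteq> U" "\<forall>v\<in>U - T. deg_in E (U - T) v \<le> 4" "\<forall>e\<in>E. \<not> e \<subseteq> T"
      "card (crossing E U T) = (4 + 1) * card T"
      using independent_deletion[OF finE finU E(2), of 4] S(2) by (auto simp: U_def)
    have fin: "finite S" "finite T" using finV finU S(1) T(1) finite_subset by blast+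
    have cST: "card (S \<union> T) = card S + card T"
      using fin T(1) by (intro card_Un_disjoint) (auto simp: U_def)
    have UT: "V - (S \<union> T) = U - T" by (auto simp: U_def)
    have "6 * card S + 5 * card T \<le> card (crossing E V S) + card (crossing E U T)"
      using S(3) T(4) by simp
    also have "\<dots> = card (crossing E V S \<union> crossing E U T)"
      using finE by (intro card_Un_disjoint[symmetric]) (auto simp: crossing_def U_def)
    also have "\<dots> \<le> card (crossing E V (S \<union> T))"
      using finE by (intro card_mono) (auto simp: crossing_def U_def)
    also have "\<dots> \<le> 3 * card (S \<union> T) + card (V - (S \<union> T))"
      using S(1) T(1) by (intro crossing_le finV E(2) conn(2)) (auto simp: U_def)
    finally have 1: "6 * card S + 5 * card T \<le> 3 * (card S + card T) + card (U - T)"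
      by (simp add: cST UT)
    have "card (crossing E U T) \<le> 2 * card T + card (U - T)"
      using T(1,3) finU E(2) conn(2) by (intro crossing_independent_le) (auto simp: U_def)
    then have 2: "5 * card T \<le> 2 * card T + card (U - T)" using T(4) by simp
    have "3 * card S + 2 * card T \<le> card (U - T)" "3 * card T \<le> card (U - T)"
      using 1 2 by simp_all
    then have "9 * (card S + card T) \<le> 4 * card (U - T)" by presburger
    then have "9 * card (S \<union> T) \<le> 4 * card (V - (S \<union> T))"
      unfolding cST UT .
    then show ?thesis
      using True S(1) T(1,2) by (intro exI[of _ "S \<union> T"]) (auto simp: UT U_def)
  qed
  then obtain S where S: "S \<subseteq> V" "\<forall>v\<in>V - S. deg_in E (V - S) v \<le> k"
    "if k = 4 then 9 * card S \<le> 4 * card (V - S) else (k - 2) * card S \<le> card (V - S)"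
    by blast
  have n: "real n = real (card (V - S)) + real (card S)"
    using assms(3) S(1) finV finite_subset[OF S(1)] card_mono[OF finV S(1)]
    by (simp add: V_def card_Diff_subset)
  have bound: "c / (c + 4) * real n \<le> real (card (V - S))"
    if c: "c > 0" "k \<noteq> 4 \<Longrightarrow> c \<le> 4 * (real k - 2)" "k = 4 \<Longrightarrow> c \<le> 9" for c
    unfolding n
  proof (rule ratio_le[OF c(1)])
    show "c * real (card S) \<le> 4 * real (card (V - S))"
    proof (cases "k = 4")
      case True
      have "c * real (card S) \<le> 9 * real (card S)"
        using c(3) True by (intro mult_right_mono) auto
      also have "\<dots> \<le> 4 * real (card (V - S))" using S(3) True by simp
      finally show ?thesis .
    next
      case False
      have "c * real (card S) \<le> 4 * (real k - 2) * real (card S)"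
        using c(2) False by (intro mult_right_mono) auto
      also have "\<dots> = 4 * real ((k - 2) * card S)" using assms(4) by (simp add: of_nat_diff)
      also have "real ((k - 2) * card S) \<le> real (card (V - S))"
        using S(3) False by (intro of_nat_mono) simp
      finally show ?thesis by simp
    qed
  qed
  show ?thesis
  proof (intro exI[of _ "V - S"] conjI impI)
    show "V - S \<subseteq> verts G" by (auto simp: V_def)
    show "max_degree (induced_subgraph G (V - S)) \<le> k"
      using S(2) finV by (intro max_degree_induced_le) (auto simp: E_def)
  next
    assume "even k"
    \<comment> \<open>At \<open>k = 4\<close> the factor 9 is met exactly; from 5 on,
      \<open>2k + 1 \<le> 4 * (k - 2)\<close>.\<close>
    then have "k = 4 \<or> k \<ge> 6" using assms(4) by presburger
    then show "(2 * real k + 1) / (2 * real k + 5) * real n \<le> real (card (V - S))"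
      using bound[of "2 * real k + 1"] by (auto simp: add.assoc)
  next
    assume "odd k"
    \<comment> \<open>The inequality \<open>2k + 2/3 \<le> 4 * (k - 2)\<close> amounts to
      \<open>k \<ge> 13/3\<close>.\<close>
    then have "k \<ge> 5" using assms(4) by presburger
    then show "(2 * real k + 2 / 3) / (2 * real k + 14 / 3) * real n \<le> real (card (V - S))"
      using bound[of "2 * real k + 2 / 3"] by (auto simp: add.assoc)
  qed
qed

end
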